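(* Let $n$ be a positive integer and $k$ a non-negative integer, and let $\mathcal{F}\subseteq 2^{[n]}$ be a family with $|A\triangle B|\le 2k+1$ for all $A,B\in\mathcal{F}$. Then either $$|\mathcal{F}|\le 2\sum_{i=0}^{k}\binom{n}{i}-2\binom{n-5k-1}{k},$$ or $\mathcal{F}$ is contained in some translate of $\mathcal{K}(n,k+1)$. Furthermore, if $\mathcal{F}$ is contained in some translate of $\mathcal{K}(n,k+1)$, then either $\mathcal{F}$ is contained in some translate of $\mathcal{K}_y(n,k)$ for some $y\in[n]$, or $$|\mathcal{F}|\le 2\sum_{i=0}^{k}\binom{n-1}{i}-\binom{n-k-2}{k}+1.$$
   Context: $[n]=\{1,\ldots,n\}$, $2^{[n]}$ is its power set and $\triangle$ denotes symmetric difference. $\mathcal{K}(n,k)=\{F\subseteq[n]: |F|\le k\}$ and, for $y\in[n]$, $\mathcal{K}_y(n,k)=\{F\subseteq[n]: |F\setminus\{y\}|\le k\}$. For a family $\mathcal{G}\subseteq 2^{[n]}$ and $S\subseteq[n]$, the translate of $\mathcal{G}$ by $S$ is $\mathcal{G}\triangle S=\{G\triangle S: G\in\mathcal{G}\}$. Binomial coefficients $\binom{a}{b}$ with $a<b$ (including negative $a$) are taken to be $0$.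
   Formalization: The "Furthermore" part is stated only for n ≤ k+2 or n ≥ 2k+2; for k+3 ≤ n ≤ 2k+1 it is false as printed: F = K(n,k+1) meets the hypotheses, lies in no translate of K_y(n,k) and exceeds the second bound (n=5, k=2: 26 > 23). *)

theory Defs
  imports Complex_Main
begin

(* Families live in Pow {1..n}; symmetric difference is the library's sym_diff. *)

definition K_ball :: "nat \<Rightarrow> nat \<Rightarrow> nat set set" where
  "K_ball n k = {F. F \<subseteq> {1..n} \<and> card F \<le> k}"

definition K_cyl :: "nat \<Rightarrow> nat \<Rightarrow> nat \<Rightarrow> nat set set" where
  "K_cyl y n k = {F. F \<subseteq> {1..n} \<and> card (F - {y}) \<le> k}"

definition translate :: "nat set set \<Rightarrow> nat set \<Rightarrow> nat set set" where
  "translate \<G> S = (\<lambda>G. sym_diff G S) ` \<G>"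

(* Binomial coefficient with an integer upper index, 0 when the upper index is smaller
   than the lower one.  Neither truncated subtraction on nat nor gchoose gives this
   convention: it makes zchoose (-1) 0 = 0. *)
definition zchoose :: "int \<Rightarrow> nat \<Rightarrow> int" where
  "zchoose a b = (if a < int b then 0 else int (nat a choose b))"

(* The "furthermore" clause of the theorem leaves out exactly the pairs with
   k+3 <= n <= 2k+1, because it is false for every one of them.  There every family
   satisfies the diameter condition, and K_ball n (k+1) has (n-1) choose (k+1) >= 2 more
   members than K_cyl y n k, whose size is 2 * (SUM i=0..k. (n-1) choose i), while the
   second bound is that size plus 1.  Smallest case: n = 5, k = 2, with 26 members against
   22 and 23. *)

end

theory Submission
  imports Defs
begin

text \<open>Part one is linear algebra.  A quadratic form on functions on the cube, supported on
  distances at least \<open>2k + 2\<close> and definite on the characters of degree strictly between \<open>k\<close> and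
  \<open>n - k\<close>, shows that the size of \<open>\<F>\<close> is at most twice the dimension of the space of polynomials of
  degree at most \<open>k\<close> restricted to \<open>\<F>\<close>.  If no translate of \<open>K_ball n (k + 1)\<close> contains \<open>\<F>\<close>, then
  after translating by a suitable member there is a set \<open>U\<close> of at most \<open>5k + 1\<close> points such that
  all monomials of degree \<open>k\<close> disjoint from \<open>U\<close> vanish on \<open>\<F>\<close>, which lowers the dimension.

  For part two, the \<open>(k+1)\<close>-sets of a subfamily of \<open>K_ball n (k + 1)\<close> are intersecting.  If they
  share an element \<open>y\<close>, the family lies in \<open>K_cyl y n k\<close>; otherwise the Hilton--Milner theorem
  bounds their number.\<close>

section \<open>Monomials not vanishing on a family of bounded diameter\<close>


text \<open>The constant \<open>5 * k + 1\<close> is a budget. The difference \<open>D\<close> of a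
  pair at maximal distance has at most \<open>2 * k + 1\<close> points, every member differs from an
  end of that pair in at most \<open>k\<close> points outside \<open>D\<close>, and three members
  may be spent. The obstacle is that a member far from one core need not exclude any other, so three
  choices must dispose of all cores; the bipartite structure of the cube makes this possible. The
  factor 2 in part one reflects the two ends of the degree range: multiplication by
  \<open>walsh V\<close> exchanges degrees at most \<open>k\<close> with degrees at least
  \<open>n - k\<close>. For Hilton--Milner, compressions produce a family in which any two members
  meet inside a set \<open>X\<close> of only \<open>2 * r\<close> points. The traces on
  \<open>X\<close> of each fixed size are then intersecting, which opens an induction on
  \<open>r\<close>, and at \<open>2 * r\<close> points complementation settles the traces of size
  \<open>r\<close>.\<close>

lemma exists_nontrivial_solution:
  fixes g :: "'j \<Rightarrow> 'x \<Rightarrow> 'a::field"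
  assumes "finite J" "finite X" "card J < card X"
  shows "\<exists>v. (\<exists>x\<in>X. v x \<noteq> 0) \<and> (\<forall>j\<in>J. (\<Sum>x\<in>X. v x * g j x) = 0)"
  using assms
proof (induction J arbitrary: X g rule: finite_induct)
  case empty
  then have "X \<noteq> {}" by auto
  then show ?case by (intro exI[of _ "\<lambda>_. 1"]) auto
next
  case (insert j J)
  show ?case
  proof (cases "\<forall>x\<in>X. g j x = 0")
    case True
    have "card J < card X" using insert by simp
    with insert.IH[OF insert.prems(1), of g] True show ?thesis by fastforce
  next
    case False
    then obtain y where y: "y \<in> X" "g j y \<noteq> 0" by blast
    define Y where "Y = X - {y}"
    have Y: "finite Y" "y \<notin> Y" "X = insert y Y" using y insert.prems by (auto simp: Y_def)
    have "card J < card Y" using insert Y by simp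
    \<comment> \<open>Gaussian elimination: equation \<open>j\<close> is solved for the unknown at
      \<open>y\<close> and substituted into the others; \<open>c\<close> below is the value this
      gives at \<open>y\<close>.\<close>
    from insert.IH[OF Y(1) this, of "\<lambda>i x. g i x - g i y * g j x / g j y"]
    obtain v where v: "\<exists>x\<in>Y. v x \<noteq> 0"
      "\<forall>i\<in>J. (\<Sum>x\<in>Y. v x * (g i x - g i y * g j x / g j y)) = 0" by blast
    define c where "c = - (\<Sum>x\<in>Y. v x * g j x) / g j y"
    define u where "u = v(y := c)"
    have sum_u: "(\<Sum>x\<in>X. u x * g i x) = c * g i y + (\<Sum>x\<in>Y. v x * g i x)" for i
    proof -
      have "(\<Sum>x\<in>Y. u x * g i x) = (\<Sum>x\<in>Y. v x * g i x)"
        by (rule sum.cong) (use Y in \<open>auto simp: u_def\<close>)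
      then show ?thesis using Y by (simp add: u_def)
    qed
    have "(\<Sum>x\<in>X. u x * g i x) = 0" if "i \<in> J" for i
    proof -
      have "0 = (\<Sum>x\<in>Y. v x * g i x) - (\<Sum>x\<in>Y. v x * g j x * (g i y / g j y))"
        using v(2) that by (simp add: right_diff_distrib sum_subtractf mult_ac)
      also have "\<dots> = (\<Sum>x\<in>Y. v x * g i x) - (\<Sum>x\<in>Y. v x * g j x) * (g i y / g j y)"
        by (simp only: sum_distrib_right)
      also have "\<dots> = (\<Sum>x\<in>Y. v x * g i x) + c * g i y"
        by (simp add: c_def)
      finally show ?thesis by (simp add: sum_u add.commute)
    qed
    moreover have "(\<Sum>x\<in>X. u x * g j x) = 0" using y by (simp add: sum_u c_def)
    moreover have "\<exists>x\<in>X. u x \<noteq> 0" using v(1) Y by (auto simp: u_def)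
    ultimately show ?thesis by (intro exI[of _ u]) auto
  qed
qed

section \<open>Walsh characters of the cube and their weighted sums\<close>

definition walsh :: "'a set \<Rightarrow> 'a set \<Rightarrow> real" where
  "walsh S A = (-1) ^ card (S \<inter> A)"

lemma walsh_commute: "walsh S A = walsh A S"
  by (simp add: walsh_def Int_commute)

lemma minus_one_power_card_sym_diff:
  assumes "finite X" "finite Y"
  shows "(-1 :: real) ^ card (sym_diff X Y) = (-1) ^ card X * (-1) ^ card Y"
proof -
  have 1: "card (sym_diff X Y) = card (X - Y) + card (Y - X)"
    using assms by (intro card_Un_disjoint) auto
  have 2: "card X = card (X - Y) + card (X \<inter> Y)"
    using card_Diff_subset_Int[of X Y] card_mono[of X "X \<inter> Y"] assms by auto
  have 3: "card Y = card (Y - X) + card (X \<inter> Y)"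
    using card_Diff_subset_Int[of Y X] card_mono[of Y "X \<inter> Y"] assms by (auto simp: Int_commute)
  show ?thesis unfolding 1 2 3 by (simp add: power_add)
qed

lemma walsh_sym_diff:
  assumes "finite S"
  shows "walsh S (sym_diff A B) = walsh S A * walsh S B"
proof -
  have "S \<inter> sym_diff A B = sym_diff (S \<inter> A) (S \<inter> B)" by auto
  then show ?thesis using assms by (simp add: walsh_def minus_one_power_card_sym_diff)
qed

lemma walsh_insert:
  assumes "finite S" "i \<notin> S"
  shows "walsh (insert i S) A = (if i \<in> A then -1 else 1) * walsh S A"
  using assms by (auto simp: walsh_def)

lemma sum_Pow_insert:
  assumes "finite W" "e \<notin> W"
  shows "(\<Sum>S\<in>Pow (insert e W). h S) = (\<Sum>S\<in>Pow W. h S) + (\<Sum>S\<in>Pow W. h (insert e S))"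
proof -
  have "inj_on (insert e) (Pow W)" using assms by (force simp: inj_on_def)
  then have "(\<Sum>S\<in>insert e ` Pow W. h S) = (\<Sum>S\<in>Pow W. h (insert e S))"
    by (simp add: sum.reindex)
  moreover have "Pow W \<inter> insert e ` Pow W = {}" using assms by auto
  ultimately show ?thesis using assms by (simp add: Pow_insert sum.union_disjoint)
qed

lemma sum_Pow_containing:
  assumes "finite V" "i \<in> V"
  shows "(\<Sum>S\<in>Pow V. of_bool (i \<in> S) * h S) = (\<Sum>S\<in>Pow (V - {i}). h (insert i S) :: real)"
proof -
  have V: "V = insert i (V - {i})" using assms by auto
  have "(\<Sum>S\<in>Pow (insert i (V - {i})). of_bool (i \<in> S) * h S)
      = (\<Sum>S\<in>Pow (V - {i}). of_bool (i \<in> S) * h S) + (\<Sum>S\<in>Pow (V - {i}). h (insert i S))"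
    using assms by (subst sum_Pow_insert) auto
  also have "(\<Sum>S\<in>Pow (V - {i}). of_bool (i \<in> S) * h S) = 0"
    by (intro sum.neutral) auto
  finally show ?thesis using V by simp
qed

lemma sum_walsh_Pow_eq_0:
  assumes "finite V" "Z \<subseteq> V" "Z \<noteq> {}"
  shows "(\<Sum>S\<in>Pow V. walsh S Z) = 0"
proof -
  from assms obtain e where e: "e \<in> Z" by blast
  define W where "W = V - {e}"
  have W: "V = insert e W" "e \<notin> W" "finite W" using e assms by (auto simp: W_def)
  have "(\<Sum>S\<in>Pow W. walsh (insert e S) Z) = (\<Sum>S\<in>Pow W. - walsh S Z)"
  proof (rule sum.cong)
    fix S assume "S \<in> Pow W"
    then have "finite S" "e \<notin> S" using W by (auto intro: finite_subset)
    then show "walsh (insert e S) Z = - walsh S Z" using e by (simp add: walsh_insert)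
  qed simp
  then show ?thesis using W by (simp add: sum_Pow_insert sum_negf)
qed

text \<open>Each linear factor in \<open>card S\<close> splits into indicators of
  \<open>i \<in> S\<close>, and fixing such an \<open>i\<close> removes at most one point from
  \<open>Z\<close>. With fewer factors than points, \<open>Z\<close> never becomes empty, so a
  vanishing character sum remains. The offset \<open>c\<close> absorbs the unit by which the
  cardinality drops when \<open>i\<close> is split off.\<close>

lemma sum_poly_card_times_walsh_eq_0:
  fixes V Z :: "'a set"
  assumes "finite V" "Z \<subseteq> V" "length rs < card Z"
  shows "(\<Sum>S\<in>Pow V. (\<Prod>r\<leftarrow>rs. real (card S) + c - r) * walsh S Z) = 0"
  using assms
proof (induction rs arbitrary: V Z c)
  case Nil
  then have "Z \<noteq> {}" by auto
  then show ?case using Nil sum_walsh_Pow_eq_0[of V Z] by simp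
next
  case (Cons r rs)
  define q where "q c m = (\<Prod>r\<leftarrow>rs. real m + c - r)" for c m
  have q_Suc: "q c (Suc m) = q (c + 1) m" for c m
    by (simp add: q_def algebra_simps)
  have IH: "(\<Sum>S\<in>Pow V'. q c' (card S) * walsh S Z') = 0"
    if "finite V'" "Z' \<subseteq> V'" "length rs < card Z'" for V' Z' :: "'a set" and c'
    unfolding q_def using Cons.IH[of V' Z' c'] that by simp
  have "(\<Sum>S\<in>Pow V. real (card S) * (q c (card S) * walsh S Z))
      = (\<Sum>S\<in>Pow V. \<Sum>i\<in>V. of_bool (i \<in> S) * (q c (card S) * walsh S Z))"
  proof (rule sum.cong)
    fix S assume "S \<in> Pow V"
    then have "real (card S) = (\<Sum>i\<in>V. of_bool (i \<in> S))"
      using Cons.prems(1) by (simp add: sum.inter_restrict[symmetric] Int_absorb1 of_bool_def)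
    then show "real (card S) * (q c (card S) * walsh S Z)
        = (\<Sum>i\<in>V. of_bool (i \<in> S) * (q c (card S) * walsh S Z))"
      by (simp only: sum_distrib_right)
  qed simp
  also have "\<dots> = (\<Sum>i\<in>V. \<Sum>S\<in>Pow V. of_bool (i \<in> S) * (q c (card S) * walsh S Z))"
    by (rule sum.swap)
  also have "\<dots> = (\<Sum>i\<in>V. \<Sum>S\<in>Pow (V - {i}). q c (card (insert i S)) * walsh (insert i S) Z)"
    using Cons.prems(1) by (intro sum.cong refl sum_Pow_containing)
  also have "\<dots> = 0"
  proof (rule sum.neutral, rule ballI)
    fix i assume i: "i \<in> V"
    have "(\<Sum>S\<in>Pow (V - {i}). q c (card (insert i S)) * walsh (insert i S) Z)
        = (\<Sum>S\<in>Pow (V - {i}). (if i \<in> Z then -1 else 1) * (q (c + 1) (card S) * walsh S (Z - {i})))"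
    proof (rule sum.cong)
      fix S assume S: "S \<in> Pow (V - {i})"
      then have "finite S" "i \<notin> S" using Cons.prems(1) by (auto intro: finite_subset)
      moreover from this have "S \<inter> (Z - {i}) = S \<inter> Z" by auto
      then have "walsh S (Z - {i}) = walsh S Z" by (simp add: walsh_def)
      ultimately show "q c (card (insert i S)) * walsh (insert i S) Z
          = (if i \<in> Z then -1 else 1) * (q (c + 1) (card S) * walsh S (Z - {i}))"
        by (simp add: walsh_insert q_Suc)
    qed simp
    also have "\<dots> = (if i \<in> Z then -1 else 1) * (\<Sum>S\<in>Pow (V - {i}). q (c + 1) (card S) * walsh S (Z - {i}))"
      by (simp only: sum_distrib_left)
    also have "(\<Sum>S\<in>Pow (V - {i}). q (c + 1) (card S) * walsh S (Z - {i})) = 0"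
    proof (rule IH)
      have "card Z - 1 \<le> card (Z - {i})"
        by (cases "i \<in> Z") (simp_all add: Diff_insert0)
      then show "length rs < card (Z - {i})" using Cons.prems(3) by simp
    qed (use Cons.prems in auto)
    finally show "(\<Sum>S\<in>Pow (V - {i}). q c (card (insert i S)) * walsh (insert i S) Z) = 0" by simp
  qed
  finally have *: "(\<Sum>S\<in>Pow V. real (card S) * (q c (card S) * walsh S Z)) = 0" .
  have "(\<Sum>S\<in>Pow V. (\<Prod>r\<leftarrow>r # rs. real (card S) + c - r) * walsh S Z)
      = (\<Sum>S\<in>Pow V. real (card S) * (q c (card S) * walsh S Z) + (c - r) * (q c (card S) * walsh S Z))"
    by (rule sum.cong) (simp_all add: q_def algebra_simps)
  also have "\<dots> = 0"
    using * IH[of V Z c] Cons.prems by (simp add: sum.distrib flip: sum_distrib_left)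
  finally show ?case .
qed

text \<open>Exactly \<open>b - i\<close> of the roots lie above \<open>i\<close>. Half-integral
  roots change the sign between consecutive integers without vanishing at any of them.\<close>

lemma alternating_prod_pos:
  assumes "a \<le> i" "i \<le> b"
  shows "0 < (-1) ^ (b - i) * (\<Prod>r\<leftarrow>map (\<lambda>j. real j + 1/2) [a..<b]. real i - r)"
  using assms(2)
proof (induction b rule: dec_induct)
  case base
  have "0 < (\<Prod>r\<leftarrow>rs. real i - r)" if "\<forall>r\<in>set rs. r < real i" for rs
    using that by (induction rs) auto
  from this[of "map (\<lambda>j. real j + 1/2) [a..<i]"] show ?case by simp
next
  case (step m)
  then have m: "a \<le> m" using assms by simp
  have "(-1) ^ (Suc m - i) * (\<Prod>r\<leftarrow>map (\<lambda>j. real j + 1/2) [a..<Suc m]. real i - r)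
     = ((-1) ^ (m - i) * (\<Prod>r\<leftarrow>map (\<lambda>j. real j + 1/2) [a..<m]. real i - r)) * (real m + 1/2 - real i)"
    using m step by (simp add: Suc_diff_le algebra_simps)
  moreover have "0 < real m + 1/2 - real i" using step by simp
  ultimately show ?case using step.IH by (metis mult_pos_pos)
qed

text \<open>The quadratic form with eigenvalue \<open>(-1)\<^sup>i q i\<close> on the characters of degree \<open>i\<close> has a
  kernel supported on distances at least \<open>n - deg q\<close>, so for \<open>deg q = n - 2k - 2\<close> it vanishes on
  functions supported on the family.  Choosing the roots of \<open>q\<close> so that these
  eigenvalues have constant sign for \<open>k < i < n - k\<close> makes the form definite on the
  orthogonal complement of the other characters.\<close>

lemma eq_0_if_orthogonal_to_extreme_walsh:
  fixes f :: "'a set \<Rightarrow> real"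
  assumes V: "finite V" and sub: "\<G> \<subseteq> Pow V"
    and diam: "\<And>A B. A \<in> \<G> \<Longrightarrow> B \<in> \<G> \<Longrightarrow> card (sym_diff A B) \<le> 2 * k + 1"
    and orth: "\<And>S. S \<subseteq> V \<Longrightarrow> card S \<le> k \<or> card V \<le> card S + k \<Longrightarrow> (\<Sum>A\<in>\<G>. f A * walsh S A) = 0"
    and "B \<in> \<G>"
  shows "f B = 0"
proof -
  have fin: "finite \<G>" using V sub by (meson finite_Pow_iff finite_subset)
  have finS: "finite S" if "S \<in> Pow V" for S using that V by (auto intro: finite_subset)
  define F where "F S = (\<Sum>A\<in>\<G>. f A * walsh S A)" for S
  have F_sq: "(F S)\<^sup>2 = (\<Sum>A\<in>\<G>. \<Sum>B\<in>\<G>. f A * f B * walsh S (sym_diff A B))" if "S \<in> Pow V" for S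
    using finS[OF that] by (simp add: F_def power2_eq_square sum_product walsh_sym_diff mult_ac)
  have F_0: "F S = 0" if S: "S \<in> Pow V" for S
  proof (cases "card S \<le> k \<or> card V \<le> card S + k")
    case True
    then show ?thesis using orth[of S] S by (auto simp: F_def)
  next
    case False
    \<comment> \<open>The degrees from \<open>a\<close> to \<open>b\<close> are those not covered by
      \<open>orth\<close>. One root in each gap between them makes \<open>card V - 2 * k - 2\<close>
      roots, one fewer than the least possible size of \<open>V - X\<close> below.\<close>
    define a b where "a = k + 1" and "b = card V - k - 1"
    define rs where "rs = map (\<lambda>j. real j + 1/2) [a..<b]"
    define w where "w i = (-1) ^ b * ((-1) ^ i * (\<Prod>r\<leftarrow>rs. real i - r))" for i
    have len: "length rs = card V - 2 * k - 2" by (simp add: rs_def a_def b_def)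
    have w_pos: "0 < w i" if "k < i" "i + k < card V" for i
    proof -
      have "a \<le> i" "i \<le> b" using that by (auto simp: a_def b_def)
      moreover have "(-1::real) ^ b * (-1) ^ i = (-1) ^ (b - i)"
      proof -
        have "(-1::real) ^ (b + i) = (-1) ^ (b - i + 2 * i)" using \<open>i \<le> b\<close> by (simp add: add.commute)
        then show ?thesis by (simp add: power_add)
      qed
      ultimately show ?thesis
        using alternating_prod_pos[of a i b] unfolding w_def rs_def mult.assoc[symmetric] by simp
    qed
    have kernel: "(\<Sum>S\<in>Pow V. w (card S) * walsh S (sym_diff A B)) = 0" if "A \<in> \<G>" "B \<in> \<G>" for A B
    proof -
      define X where "X = sym_diff A B"
      have X: "X \<subseteq> V" "card X \<le> 2 * k + 1" using that sub diam by (auto simp: X_def)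
      \<comment> \<open>The alternating sign replaces \<open>X\<close> by its complement, so a small
        distance becomes a large set, as the vanishing of the character sum requires.\<close>
      have flip: "(-1) ^ card T * walsh T X = walsh T (V - X)" if "T \<in> Pow V" for T
      proof -
        have "finite T" using finS that .
        moreover have "T = sym_diff (T \<inter> X) (T \<inter> (V - X))" using that by auto
        ultimately have "(-1::real) ^ card T = (-1) ^ card (T \<inter> X) * (-1) ^ card (T \<inter> (V - X))"
          using minus_one_power_card_sym_diff[of "T \<inter> X" "T \<inter> (V - X)"] by simp
        then show ?thesis by (simp add: walsh_def)
      qed
      have "(\<Sum>T\<in>Pow V. w (card T) * walsh T X)
          = (\<Sum>T\<in>Pow V. (-1) ^ b * ((\<Prod>r\<leftarrow>rs. real (card T) + 0 - r) * walsh T (V - X)))"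
        by (rule sum.cong) (simp_all add: w_def flip[symmetric] mult_ac)
      also have "\<dots> = (-1) ^ b * (\<Sum>T\<in>Pow V. (\<Prod>r\<leftarrow>rs. real (card T) + 0 - r) * walsh T (V - X))"
        by (simp only: sum_distrib_left)
      also have "(\<Sum>T\<in>Pow V. (\<Prod>r\<leftarrow>rs. real (card T) + 0 - r) * walsh T (V - X)) = 0"
      proof (rule sum_poly_card_times_walsh_eq_0)
        have "card (V - X) = card V - card X" using X V by (simp add: card_Diff_subset finite_subset)
        then show "length rs < card (V - X)" using X False len by linarith
      qed (use V in auto)
      finally show ?thesis by (simp add: X_def)
    qed
    have "(\<Sum>T\<in>Pow V. w (card T) * (F T)\<^sup>2)
        = (\<Sum>T\<in>Pow V. \<Sum>A\<in>\<G>. \<Sum>B\<in>\<G>. f A * f B * (w (card T) * walsh T (sym_diff A B)))"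
      by (rule sum.cong) (simp_all add: F_sq sum_distrib_left mult_ac)
    also have "\<dots> = (\<Sum>A\<in>\<G>. \<Sum>T\<in>Pow V. \<Sum>B\<in>\<G>. f A * f B * (w (card T) * walsh T (sym_diff A B)))"
      by (rule sum.swap)
    also have "\<dots> = (\<Sum>A\<in>\<G>. \<Sum>B\<in>\<G>. \<Sum>T\<in>Pow V. f A * f B * (w (card T) * walsh T (sym_diff A B)))"
      by (intro sum.cong refl sum.swap)
    also have "\<dots> = (\<Sum>A\<in>\<G>. \<Sum>B\<in>\<G>. f A * f B * (\<Sum>T\<in>Pow V. w (card T) * walsh T (sym_diff A B)))"
      by (simp only: sum_distrib_left)
    also have "\<dots> = 0" by (simp add: kernel)
    finally have "(\<Sum>T\<in>Pow V. w (card T) * (F T)\<^sup>2) = 0" .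
    moreover have "0 \<le> w (card T) * (F T)\<^sup>2" if "T \<in> Pow V" for T
    proof (cases "card T \<le> k \<or> card V \<le> card T + k")
      case True
      then show ?thesis using orth[of T] that by (auto simp: F_def)
    next
      case False
      then show ?thesis using w_pos[of "card T"] by simp
    qed
    ultimately have "w (card S) * (F S)\<^sup>2 = 0"
      using V S by (subst (asm) sum_nonneg_eq_0_iff) auto
    then show ?thesis using w_pos[of "card S"] False by auto
  qed
  \<comment> \<open>Fourier inversion: all coefficients of \<open>f\<close> vanish, hence so does
    \<open>f\<close>.\<close>
  have "0 = (\<Sum>S\<in>Pow V. F S * walsh S B)" using F_0 by simp
  also have "\<dots> = (\<Sum>S\<in>Pow V. \<Sum>A\<in>\<G>. f A * walsh S (sym_diff A B))"
    by (rule sum.cong) (use finS in \<open>simp_all add: F_def sum_distrib_left walsh_sym_diff mult_ac\<close>)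
  also have "\<dots> = (\<Sum>A\<in>\<G>. \<Sum>S\<in>Pow V. f A * walsh S (sym_diff A B))"
    by (rule sum.swap)
  also have "\<dots> = (\<Sum>A\<in>\<G>. f A * (\<Sum>S\<in>Pow V. walsh S (sym_diff A B)))"
    by (simp only: sum_distrib_left)
  also have "\<dots> = (\<Sum>A\<in>\<G>. if A = B then f A * 2 ^ card V else 0)"
  proof (rule sum.cong)
    fix A assume A: "A \<in> \<G>"
    show "f A * (\<Sum>S\<in>Pow V. walsh S (sym_diff A B)) = (if A = B then f A * 2 ^ card V else 0)"
    proof (cases "A = B")
      case True
      then show ?thesis using V by (simp add: walsh_def card_Pow)
    next
      case False
      have "(\<Sum>S\<in>Pow V. walsh S (sym_diff A B)) = 0"
        by (rule sum_walsh_Pow_eq_0) (use A \<open>B \<in> \<G>\<close> sub V False in auto)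
      then show ?thesis using False by simp
    qed
  qed simp
  also have "\<dots> = f B * 2 ^ card V" using fin \<open>B \<in> \<G>\<close> by simp
  finally show ?thesis by simp
qed

text \<open>Expansion of the product over \<open>S\<close> of the factors 1 - 2x, where x is the
  indicator of a point in \<open>A\<close>. It shows that a character of degree at most
  \<open>k\<close> is a combination of monomials of degree at most \<open>k\<close>.\<close>

lemma walsh_eq_sum_monomials:
  assumes "finite S"
  shows "walsh S A = (\<Sum>T\<in>Pow S. (-2) ^ card T * of_bool (T \<subseteq> A))"
  using assms
proof (induction S rule: finite_induct)
  case empty
  then show ?case by (simp add: walsh_def)
next
  case (insert x S)
  have "(\<Sum>T\<in>Pow S. (-2) ^ card (insert x T) * of_bool (insert x T \<subseteq> A))
      = (\<Sum>T\<in>Pow S. (-2 * of_bool (x \<in> A)) * ((-2) ^ card T * of_bool (T \<subseteq> A)) :: real)"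
  proof (rule sum.cong)
    fix T assume "T \<in> Pow S"
    then have "finite T" "x \<notin> T" using insert.hyps by (auto intro: finite_subset)
    then show "(-2) ^ card (insert x T) * of_bool (insert x T \<subseteq> A)
      = ((-2 * of_bool (x \<in> A)) * ((-2) ^ card T * of_bool (T \<subseteq> A)) :: real)" by simp
  qed simp
  also have "\<dots> = -2 * of_bool (x \<in> A) * walsh S A"
    by (simp only: insert.IH sum_distrib_left)
  finally show ?case
    by (simp only: sum_Pow_insert[OF insert.hyps] walsh_insert[OF insert.hyps] insert.IH[symmetric]) simp
qed

text \<open>A larger family would carry a nonzero \<open>f\<close> orthogonal to every monomial in
  \<open>J\<close>, both as it is and multiplied by \<open>walsh V\<close>. The remaining monomials
  vanish on the family, so \<open>f\<close> is orthogonal to all characters of degree at most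
  \<open>k\<close>, and, via the factor \<open>walsh V\<close>, to their complementary characters as
  well. That forces \<open>f\<close> to vanish.\<close>

lemma card_le_twice_nonvanishing_monomials:
  assumes V: "finite V" and sub: "\<G> \<subseteq> Pow V"
    and diam: "\<And>A B. A \<in> \<G> \<Longrightarrow> B \<in> \<G> \<Longrightarrow> card (sym_diff A B) \<le> 2 * k + 1"
    and J: "finite J"
    and vanish: "\<And>S A. S \<subseteq> V \<Longrightarrow> card S \<le> k \<Longrightarrow> S \<notin> J \<Longrightarrow> A \<in> \<G> \<Longrightarrow> \<not> S \<subseteq> A"
  shows "card \<G> \<le> 2 * card J"
proof (rule ccontr)
  assume "\<not> card \<G> \<le> 2 * card J"
  then have lt: "card (J \<times> (UNIV :: bool set)) < card \<G>" by (simp add: card_cartesian_product)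
  have fin: "finite \<G>" using V sub by (meson finite_Pow_iff finite_subset)
  define g where "g = (\<lambda>(S, b) A. (if b then walsh V A else 1) * of_bool (S \<subseteq> A) :: real)"
  from exists_nontrivial_solution[OF _ fin lt, of g] J obtain f where
    f: "\<exists>A\<in>\<G>. f A \<noteq> 0" "\<forall>j\<in>J \<times> UNIV. (\<Sum>A\<in>\<G>. f A * g j A) = 0" by auto
  have mono: "(\<Sum>A\<in>\<G>. f A * g (S, b) A) = 0" if "S \<subseteq> V" "card S \<le> k" for S b
  proof (cases "S \<in> J")
    case True
    then show ?thesis using f(2) by blast
  next
    case False
    then show ?thesis using vanish[OF that False] by (intro sum.neutral) (auto simp: g_def)
  qed
  have low: "(\<Sum>A\<in>\<G>. f A * ((if b then walsh V A else 1) * walsh S A)) = 0"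
    if S: "S \<subseteq> V" "card S \<le> k" for S b
  proof -
    have finS: "finite S" using S V by (auto intro: finite_subset)
    have "(\<Sum>A\<in>\<G>. f A * ((if b then walsh V A else 1) * walsh S A))
        = (\<Sum>A\<in>\<G>. \<Sum>T\<in>Pow S. (-2) ^ card T * (f A * g (T, b) A))"
      by (simp add: walsh_eq_sum_monomials[OF finS] g_def sum_distrib_left mult_ac)
    also have "\<dots> = (\<Sum>T\<in>Pow S. \<Sum>A\<in>\<G>. (-2) ^ card T * (f A * g (T, b) A))"
      by (rule sum.swap)
    also have "\<dots> = (\<Sum>T\<in>Pow S. (-2) ^ card T * (\<Sum>A\<in>\<G>. f A * g (T, b) A))"
      by (simp only: sum_distrib_left)
    also have "\<dots> = 0"
    proof (rule sum.neutral, rule ballI)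
      fix T assume "T \<in> Pow S"
      then have "T \<subseteq> V" "card T \<le> k" using S card_mono[OF finS, of T] by auto
      then show "(-2) ^ card T * (\<Sum>A\<in>\<G>. f A * g (T, b) A) = 0" using mono by simp
    qed
    finally show ?thesis .
  qed
  have "(\<Sum>A\<in>\<G>. f A * walsh S A) = 0" if S: "S \<subseteq> V" "card S \<le> k \<or> card V \<le> card S + k" for S
  proof (cases "card S \<le> k")
    case True
    then show ?thesis using low[of S False] S by simp
  next
    case False
    have "card (V - S) \<le> k" using S False V by (simp add: card_Diff_subset finite_subset)
    then have "(\<Sum>A\<in>\<G>. f A * (walsh V A * walsh (V - S) A)) = 0" using low[of "V - S" True] by simp
    moreover have "walsh V A * walsh (V - S) A = walsh S A" if "A \<in> \<G>" for A
    proof -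
      have "finite A" using that sub V by (meson PowD finite_subset subsetD)
      moreover have "S = sym_diff V (V - S)" using S by auto
      ultimately show ?thesis
        using walsh_sym_diff[of A V "V - S"] by (simp add: walsh_commute)
    qed
    ultimately show ?thesis by simp
  qed
  then have "f A = 0" if "A \<in> \<G>" for A
    using eq_0_if_orthogonal_to_extreme_walsh[OF V sub diam, of f] that by blast
  with f(1) show False by blast
qed

section \<open>A small set blocking all monomials of degree k\<close>


abbreviation (input) hamming :: "'a set \<Rightarrow> 'a set \<Rightarrow> nat" where
  "hamming A B \<equiv> card (sym_diff A B)"

lemma hamming_eq_0_iff:
  assumes "finite X" "finite Y"
  shows "hamming X Y = 0 \<longleftrightarrow> X = Y"
  using assms by auto

lemma hamming_commute: "hamming X Y = hamming Y X"
  by (simp add: Un_commute)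

text \<open>The cube is bipartite, so a closed walk through three vertices has even length.\<close>

lemma hamming_parity:
  assumes "finite X" "finite Y" "finite Z"
  shows "even (hamming X Y + hamming Y Z + hamming X Z)"
proof -
  have card_sd: "\<exists>m. hamming A B + 2 * m = card A + card B" if "finite A" "finite B" for A B :: "'a set"
  proof -
    have "hamming A B = card (A - B) + card (B - A)"
      using that by (intro card_Un_disjoint) auto
    moreover have "card A = card (A \<inter> B) + card (A - B)" "card B = card (A \<inter> B) + card (B - A)"
      using that card_Int_Diff[of A B] card_Int_Diff[of B A] by (simp_all add: Int_commute)
    ultimately show ?thesis by (intro exI[of _ "card (A \<inter> B)"]) simp
  qed
  from card_sd[of X Y] card_sd[of Y Z] card_sd[of X Z] assms obtain a b c where
    "hamming X Y + 2 * a = card X + card Y" "hamming Y Z + 2 * b = card Y + card Z"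
    "hamming X Z + 2 * c = card X + card Z" by blast
  then have "hamming X Y + hamming Y Z + hamming X Z + 2 * (a + b + c) = 2 * (card X + card Y + card Z)"
    by simp
  then show ?thesis by (metis dvd_add_left_iff dvd_triv_left)
qed

lemma hamming_sym_diff_disjoint:
  assumes "finite P" "finite C" "finite T" "T \<inter> sym_diff P C = {}"
  shows "hamming (sym_diff P T) C = hamming P C + card T"
proof -
  have "sym_diff (sym_diff P T) C = sym_diff P C \<union> T" using assms(4) by auto
  moreover have "sym_diff P C \<inter> T = {}" using assms(4) by blast
  ultimately show ?thesis using assms(1-3) by (simp only: card_Un_disjoint finite_Un finite_Diff)
qed

lemma hamming_eq_1_obtains:
  assumes "hamming X Y = 1"
  obtains e where "Y = sym_diff X {e}"
proof -
  from assms obtain e where "sym_diff X Y = {e}" by (auto simp: card_1_singleton_iff)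
  then have "Y = sym_diff X {e}" by auto
  then show ?thesis by (rule that)
qed

lemma hamming_flip:
  assumes "finite X" "finite A"
  shows "int (hamming (sym_diff X {e}) A) = int (hamming X A) + (if e \<in> sym_diff X A then -1 else 1)"
proof (cases "e \<in> sym_diff X A")
  case True
  then have "sym_diff (sym_diff X {e}) A = sym_diff X A - {e}" by auto
  moreover have "0 < hamming X A" using True assms card_gt_0_iff by fastforce
  ultimately show ?thesis using True assms by (simp add: card_Diff_singleton)
next
  case False
  then have "{e} \<inter> sym_diff X A = {}" by blast
  then show ?thesis using False hamming_sym_diff_disjoint[of X A "{e}"] assms by simp
qed

lemma zero_if_even_Suc_add:
  assumes "a \<le> 1" "b \<le> 1" "even (1 + b + a)"
  shows "a = 0 \<or> b = (0::nat)"
  using assms by presburger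

lemma odd_le_1:
  assumes "a \<le> 1"
  shows "odd a \<longleftrightarrow> a = (1::nat)" and "even a \<longleftrightarrow> a = 0"
  using assms by presburger+

text \<open>Parity puts \<open>x\<close> and \<open>p\<close> on one of the two levels and
  \<open>y\<close> and \<open>z\<close> on the other.\<close>

lemma alternating_levels:
  assumes "x = k \<or> x = k + 1" "y = k \<or> y = k + 1" "z = k \<or> z = k + 1" "p = k \<or> p = k + 1"
    and "odd (x + y)" "odd (x + z)" "odd (z + p)"
  shows "x + p \<noteq> y + (z::nat)"
  using assms by auto

text \<open>The cycle flips two distinct points, and \<open>P\<close> has both flipped. The effect
  of a flip on the distance to \<open>A\<close> does not depend on whether the other point has been
  flipped.\<close>

lemma hamming_four_cycle:
  assumes fin: "finite X" "finite A"
    and XY: "hamming X Y = 1" and YP: "hamming Y P = 1"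
    and XZ: "hamming X Z = 1" and ZP: "hamming Z P = 1"
    and neq: "X \<noteq> P" "Y \<noteq> Z"
  shows "hamming X A + hamming P A = hamming Y A + hamming Z A"
proof -
  obtain e where e: "Y = sym_diff X {e}" using XY by (rule hamming_eq_1_obtains)
  obtain f where f: "Z = sym_diff X {f}" using XZ by (rule hamming_eq_1_obtains)
  obtain g where g: "P = sym_diff Y {g}" using YP by (rule hamming_eq_1_obtains)
  obtain h where h: "P = sym_diff Z {h}" using ZP by (rule hamming_eq_1_obtains)
  have ef: "e \<noteq> f" using neq e f by auto
  have "e \<noteq> g" using neq e g by auto
  have "g = f"
  proof (rule ccontr)
    assume "g \<noteq> f"
    then have "e \<in> P \<longleftrightarrow> e \<notin> X" "g \<in> P \<longleftrightarrow> g \<notin> X" "f \<in> P \<longleftrightarrow> f \<in> X"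
      using e g ef \<open>e \<noteq> g\<close> by auto
    moreover have "x \<in> P \<longleftrightarrow> x \<in> X" if "x \<noteq> f" "x \<noteq> h" for x using f h that by auto
    ultimately show False using ef \<open>g \<noteq> f\<close> \<open>e \<noteq> g\<close> by metis
  qed
  have "f \<in> sym_diff Y A \<longleftrightarrow> f \<in> sym_diff X A" using e ef by auto
  moreover have "finite Y" using e fin by simp
  ultimately show ?thesis
    using hamming_flip[of X A e] hamming_flip[of X A f] hamming_flip[of Y A f] fin
    unfolding e[symmetric] f[symmetric] g[unfolded \<open>g = f\<close>, symmetric] by (simp split: if_splits)
qed

text \<open>Let \<open>A\<close> and \<open>B\<close> realise the diameter and \<open>D = A \<triangle> B\<close>.  A set \<open>T\<close> of size \<open>k\<close> disjoint
  from \<open>D\<close> lies in some \<open>F \<triangle> A\<close> only if \<open>F = P \<triangle> T\<close> with \<open>P \<triangle> A \<subseteq> D\<close>; call \<open>P\<close> a core.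
  Members far from \<open>P\<close> exclude \<open>P\<close> as a core of sets \<open>T\<close> disjoint from them, and cores of disjoint
  sets \<open>T\<close> have distance at most 1.  Hence few members of the family exclude all cores.\<close>

lemma exists_blocking_set:
  fixes \<F> :: "'a set set"
  assumes V: "finite V" and sub: "\<F> \<subseteq> Pow V"
    and diam: "\<And>A B. A \<in> \<F> \<Longrightarrow> B \<in> \<F> \<Longrightarrow> hamming A B \<le> 2 * k + 1"
    and far: "\<And>S. S \<subseteq> V \<Longrightarrow> \<exists>C\<in>\<F>. k + 2 \<le> hamming C S"
  obtains A U where "A \<in> \<F>" "finite U" "card U \<le> 5 * k + 1"
    "\<And>T F. T \<subseteq> V \<Longrightarrow> card T = k \<Longrightarrow> T \<inter> U = {} \<Longrightarrow> F \<in> \<F> \<Longrightarrow> \<not> T \<subseteq> sym_diff F A"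
proof -
  note result = that
  have fin: "finite C" if "C \<in> \<F>" for C using that sub V by (auto intro: finite_subset)
  define dists where "dists = (\<lambda>(A, B). hamming A B) ` (\<F> \<times> \<F>)"
  have "finite \<F>" using V sub by (meson finite_Pow_iff finite_subset)
  moreover have "\<F> \<noteq> {}" using far[of "{}"] by auto
  ultimately have dists: "finite dists" "dists \<noteq> {}" by (auto simp: dists_def)
  define m where "m = Max dists"
  have "m \<in> dists" unfolding m_def using dists by (rule Max_in)
  then obtain A B where AB: "A \<in> \<F>" "B \<in> \<F>" "hamming A B = m" by (auto simp: dists_def)
  have m_max: "hamming C C' \<le> m" if "C \<in> \<F>" "C' \<in> \<F>" for C C'
    unfolding m_def using dists that by (intro Max_ge) (auto simp: dists_def)
  have m_le: "m \<le> 2 * k + 1" using AB diam by auto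
  define D where "D = sym_diff A B"
  have finAB: "finite A" "finite B" "finite D" using AB fin by (auto simp: D_def)
  have DV: "D \<subseteq> V" using AB sub by (auto simp: D_def)
  \<comment> \<open>A point outside \<open>D\<close> where \<open>C\<close> differs from
    \<open>A\<close> counts in the distances to both ends, so these add up to \<open>m\<close> plus
    twice the outside part. The sum is at most \<open>2 * m\<close>, and \<open>m\<close> is at most
    \<open>2 * k + 1\<close>.\<close>
  have outside: "card (sym_diff C A - D) \<le> k" if "C \<in> \<F>" for C
  proof -
    have finC: "finite C" using fin that .
    have "hamming C A = card (sym_diff C A \<inter> D) + card (sym_diff C A - D)"
      using finC finAB by (intro card_Int_Diff) auto
    moreover have "hamming C B = card (D - sym_diff C A) + card (sym_diff C A - D)"
    proof -
      have "sym_diff C B = (D - sym_diff C A) \<union> (sym_diff C A - D)" by (auto simp: D_def)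
      then show ?thesis using finC finAB by (simp only:) (rule card_Un_disjoint; auto)
    qed
    moreover have "m = card (sym_diff C A \<inter> D) + card (D - sym_diff C A)"
      using card_Int_Diff[OF finAB(3), of "sym_diff C A"] AB(3) by (simp add: D_def Int_commute)
    ultimately show ?thesis using m_max[OF that AB(1)] m_max[OF that AB(2)] m_le by linarith
  qed
  \<comment> \<open>The price of a member: absorbing its difference from \<open>A\<close> costs at
    most \<open>k\<close> points, so three members fit on top of \<open>D\<close>.\<close>
  have grow: "card (U \<union> sym_diff C A) \<le> card U + k" if "C \<in> \<F>" "D \<subseteq> U" "finite U" for C U
  proof -
    have "card (U \<union> sym_diff C A) = card (U \<union> (sym_diff C A - D))"
      by (rule arg_cong[of _ _ card]) (use that in blast)
    also have "\<dots> \<le> card U + card (sym_diff C A - D)" by (rule card_Un_le)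
    also have "\<dots> \<le> card U + k" using outside[OF that(1)] by simp
    finally show ?thesis .
  qed
  define core where "core U P \<longleftrightarrow> sym_diff P A \<subseteq> D \<and>
      (\<exists>T. finite T \<and> card T = k \<and> T \<inter> U = {} \<and> sym_diff P T \<in> \<F>)" for U P
  have core_fin: "finite P" "P \<subseteq> V" if "core U P" for U P
  proof -
    have "P \<subseteq> A \<union> D" using that unfolding core_def by blast
    then show "finite P" "P \<subseteq> V" using finAB AB(1) sub DV by (auto intro: finite_subset)
  qed
  have finish: thesis if U: "D \<subseteq> U" "finite U" "card U \<le> 5 * k + 1" "\<And>P. \<not> core U P" for U
  proof (rule result)
    show "A \<in> \<F>" "finite U" "card U \<le> 5 * k + 1" by fact+
    fix T F assume T: "T \<subseteq> V" "card T = k" "T \<inter> U = {}" "F \<in> \<F>"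
    show "\<not> T \<subseteq> sym_diff F A"
    proof
      assume TF: "T \<subseteq> sym_diff F A"
      have "finite F" using T fin by blast
      have TD: "T \<subseteq> sym_diff F A - D" using TF T(3) U(1) by blast
      have "T = sym_diff F A - D"
        using TD T(2) outside[OF T(4)] \<open>finite F\<close> finAB by (intro card_seteq) auto
      then have "sym_diff (sym_diff F T) A \<subseteq> D" by auto
      moreover have "sym_diff (sym_diff F T) T = F" by auto
      moreover have "finite T" using T(1) V by (rule finite_subset)
      ultimately have "core U (sym_diff F T)" unfolding core_def using T by auto
      with U(4) show False by blast
    qed
  qed
  \<comment> \<open>\<open>T\<close> avoids the points where \<open>P\<close> and \<open>C\<close>
    differ, so it adds its full size \<open>k\<close> to the distance. Since
    \<open>m - k \<le> k + 1\<close>, an absorbed member at distance \<open>k + 2\<close> or more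
    from \<open>P\<close> excludes \<open>P\<close> as a core.\<close>
  have core_dist: "hamming P C + k \<le> m"
    if P: "core U P" and "C \<in> \<F>" "D \<subseteq> U" "sym_diff C A \<subseteq> U" for U P C
  proof -
    from P obtain T where T: "finite T" "card T = k" "T \<inter> U = {}" "sym_diff P T \<in> \<F>"
      and PA: "sym_diff P A \<subseteq> D" unfolding core_def by blast
    have "T \<inter> sym_diff P C = {}" using T(3) that(3,4) PA by blast
    then have "hamming (sym_diff P T) C = hamming P C + k"
      using core_fin[OF P] fin[OF that(2)] T by (simp add: hamming_sym_diff_disjoint)
    then show ?thesis using m_max[OF T(4) that(2)] by simp
  qed
  have not_far: "\<not> k + 2 \<le> hamming C P"
    if "core U P" "C \<in> \<F>" "D \<subseteq> U" "sym_diff C A \<subseteq> U" for U P C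
    using core_dist[OF that] m_le hamming_commute[of C P] by linarith
  \<comment> \<open>The member that makes \<open>P\<close> a core is itself a test: once it is
    absorbed, \<open>core_dist\<close> confines all further cores to distance
    \<open>m - 2 * k \<le> 1\<close> from \<open>P\<close>.\<close>
  have witness: "\<exists>F\<in>\<F>. \<forall>X. sym_diff X A \<subseteq> D \<longrightarrow> hamming F X = hamming P X + k"
    if P: "core U P" and "D \<subseteq> U" for U P
  proof -
    from P obtain T where T: "finite T" "card T = k" "T \<inter> U = {}" "sym_diff P T \<in> \<F>"
      and PA: "sym_diff P A \<subseteq> D" unfolding core_def by blast
    have "hamming (sym_diff P T) X = hamming P X + k" if "sym_diff X A \<subseteq> D" for X
    proof -
      have "X \<subseteq> A \<union> D" using that by blast
      then have "finite X" using finAB by (auto intro: finite_subset)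
      moreover have "T \<inter> sym_diff P X = {}" using T(3) PA that \<open>D \<subseteq> U\<close> by blast
      ultimately show ?thesis
        using core_fin[OF P] T by (simp add: hamming_sym_diff_disjoint)
    qed
    then show ?thesis using T(4) by blast
  qed
  have coreD: "sym_diff P A \<subseteq> D" if "core U P" for U P using that unfolding core_def by blast
  have core_mono: "core U' P" if "core U P" "U' \<subseteq> U" for U U' P using that unfolding core_def by blast
  \<comment> \<open>When \<open>m = 2 * k + 1\<close>, this leaves only \<open>k\<close> and
    \<open>k + 1\<close> as distances from a core to \<open>A\<close>.\<close>
  have level: "hamming P A + k \<le> m \<and> hamming P B + k \<le> m \<and> hamming P A + hamming P B = m"
    if P: "core U P" and "D \<subseteq> U" for U P
  proof -
    have "sym_diff P B = D - sym_diff P A" using coreD[OF P] by (auto simp: D_def)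
    then have "hamming P B = card D - hamming P A"
      using coreD[OF P] core_fin[OF P] finAB by (simp add: card_Diff_subset)
    moreover have "hamming P A \<le> card D" using coreD[OF P] finAB by (intro card_mono) auto
    moreover have "card D = m" using AB by (simp add: D_def)
    moreover have "sym_diff B A \<subseteq> U" using that(2) by (auto simp: D_def)
    ultimately show ?thesis
      using core_dist[OF P AB(1) that(2)] core_dist[OF P AB(2) that(2)] by simp
  qed
  have D_card: "card D = m" using AB by (simp add: D_def)
  show thesis
  proof (cases "\<exists>P. core D P")
    case False
    then show thesis using finish[of D] D_card m_le finAB(3) by auto
  next
    case True
    then obtain P0 where P0: "core D P0" by blast
    from witness[OF P0] obtain F0 where F0: "F0 \<in> \<F>"
      "\<And>X. sym_diff X A \<subseteq> D \<Longrightarrow> hamming F0 X = hamming P0 X + k" by blast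
    define U1 where "U1 = D \<union> sym_diff F0 A"
    have U1: "D \<subseteq> U1" "finite U1" "card U1 \<le> m + k" "sym_diff F0 A \<subseteq> U1"
      using grow[OF F0(1), of D] finAB D_card fin[OF F0(1)] by (auto simp: U1_def)
    have near0: "hamming P0 P + 2 * k \<le> m" if "core U P" "U1 \<subseteq> U" for U P
      using core_dist[OF that(1) F0(1)] F0(2)[OF coreD[OF that(1)]] that(2) U1
        hamming_commute[of P F0] by force
    obtain C0 where C0: "C0 \<in> \<F>" "k + 2 \<le> hamming C0 P0" using far[of P0] core_fin[OF P0] by blast
    show thesis
    proof (cases "\<exists>P. core U1 P \<and> P \<noteq> P0")
      case False
      define U where "U = U1 \<union> sym_diff C0 A"
      have "card U \<le> 5 * k + 1" using grow[OF C0(1) U1(1,2)] U1(3) m_le by (simp add: U_def)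
      moreover have "\<not> core U P" for P
      proof
        assume P: "core U P"
        then have "core U1 P" using core_mono[of U P U1] by (auto simp: U_def)
        then have "P = P0" using False by blast
        then show False using not_far[OF P C0(1)] C0(2) U1(1) by (auto simp: U_def)
      qed
      ultimately show thesis using finish[of U] U1(1,2) fin[OF C0(1)] finAB(1) by (auto simp: U_def)
    next
      case True
      then obtain P1 where P1: "core U1 P1" "P1 \<noteq> P0" by blast
      have finP: "finite P0" "finite P1" using core_fin P0 P1 by blast+
      have "hamming P0 P1 + 2 * k \<le> m" using near0[OF P1(1)] by simp
      moreover have "hamming P0 P1 \<noteq> 0" using P1(2) finP hamming_eq_0_iff by metis
      ultimately have P01: "hamming P0 P1 = 1" and m: "m = 2 * k + 1" using m_le by linarith+
      from witness[OF P1(1) U1(1)] obtain F1 where F1: "F1 \<in> \<F>"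
        "\<And>X. sym_diff X A \<subseteq> D \<Longrightarrow> hamming F1 X = hamming P1 X + k" by blast
      show thesis
      proof (cases "\<exists>C\<in>\<F>. k + 2 \<le> hamming C P0 \<and> k + 2 \<le> hamming C P1")
        case True
        then obtain C where C: "C \<in> \<F>" "k + 2 \<le> hamming C P0" "k + 2 \<le> hamming C P1" by blast
        define U2 where "U2 = U1 \<union> sym_diff F1 A"
        define U where "U = U2 \<union> sym_diff C A"
        have U2: "card U2 \<le> 4 * k + 1" "finite U2" "D \<subseteq> U2"
          using grow[OF F1(1) U1(1,2)] U1 m fin[OF F1(1)] finAB by (auto simp: U2_def)
        then have U: "card U \<le> 5 * k + 1" "D \<subseteq> U" "U1 \<subseteq> U" "sym_diff F1 A \<subseteq> U" "sym_diff C A \<subseteq> U" "finite U"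
          using grow[OF C(1), of U2] fin[OF C(1)] finAB(1) by (auto simp: U_def U2_def)
        have "\<not> core U P" for P
        proof
          assume P: "core U P"
          have finP': "finite P" using core_fin P by blast
          \<comment> \<open>A core of \<open>U\<close> is within distance 1 of both adjacent sets
            \<open>P0\<close> and \<open>P1\<close>. The cube has no triangles, so it is one of
            them, and \<open>C\<close> excludes both.\<close>
          have "hamming P0 P \<le> 1" using near0[OF P U(3)] m by simp
          moreover have "hamming P1 P \<le> 1"
            using core_dist[OF P F1(1) U(2,4)] F1(2)[OF coreD[OF P]] m hamming_commute[of P F1] by simp
          moreover have "even (hamming P0 P1 + hamming P1 P + hamming P0 P)"
            using hamming_parity finP finP' by blast
          ultimately have "hamming P0 P = 0 \<or> hamming P1 P = 0"
            unfolding P01 by (rule zero_if_even_Suc_add)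
          then have "P = P0 \<or> P = P1" using hamming_eq_0_iff finP finP' by metis
          then show False using not_far[OF P C(1) U(2,5)] C by blast
        qed
        then show thesis using finish[of U] U by blast
      next
        case False
        then have near: "hamming C P0 \<le> k + 1 \<or> hamming C P1 \<le> k + 1" if "C \<in> \<F>" for C
        proof -
          have "\<not> (k + 2 \<le> hamming C P0 \<and> k + 2 \<le> hamming C P1)" using False that by blast
          then show ?thesis by linarith
        qed
        \<comment> \<open>The budget is spent on a witness of \<open>Z\<close>, a member far from
          \<open>X\<close> and a member far from \<open>Z\<close>. A surviving core \<open>P\<close>
          is adjacent to \<open>Z\<close> and at distance at least 2 from \<open>X\<close>; then its
          witness is far from \<open>X\<close>, so \<open>near\<close> makes \<open>P\<close>
          adjacent to \<open>Y\<close>. The 4-cycle \<open>X\<close>, \<open>Y\<close>,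
          \<open>P\<close>, \<open>Z\<close> would alternate between the two levels \<open>k\<close>
          and \<open>k + 1\<close>, contrary to \<open>hamming_four_cycle\<close>. Three sets
          \<open>U\<close>, \<open>U'\<close>, \<open>U''\<close> occur because the cores come from
          different stages.\<close>
        have third: thesis
          if X: "core U X" and Y: "core U' Y" and Z: "core U'' Z" and sub': "D \<subseteq> U" "D \<subseteq> U'" "D \<subseteq> U''"
            and XY: "hamming X Y = 1" and ZX: "hamming Z X = 1" and "Z \<noteq> Y"
            and near: "\<And>C. C \<in> \<F> \<Longrightarrow> hamming C X \<le> k + 1 \<or> hamming C Y \<le> k + 1"
          for X Y Z U U' U''
        proof -
          have finX: "finite X" "finite Y" "finite Z" using core_fin X Y Z by blast+
          from witness[OF Z sub'(3)] obtain F where F: "F \<in> \<F>"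
            "\<And>X. sym_diff X A \<subseteq> D \<Longrightarrow> hamming F X = hamming Z X + k" by blast
          obtain C where C: "C \<in> \<F>" "k + 2 \<le> hamming C X" using far[of X] core_fin[OF X] by blast
          obtain C' where C': "C' \<in> \<F>" "k + 2 \<le> hamming C' Z" using far[of Z] core_fin[OF Z] by blast
          define W1 where "W1 = D \<union> sym_diff F A"
          define W2 where "W2 = W1 \<union> sym_diff C A"
          define W where "W = W2 \<union> sym_diff C' A"
          have fins: "finite W1" "finite W2" "finite W"
            using fin F C C' finAB by (auto simp: W1_def W2_def W_def)
          have "card W \<le> card W2 + k" unfolding W_def
            by (rule grow) (use C' fins in \<open>auto simp: W1_def W2_def\<close>)
          moreover have "card W2 \<le> card W1 + k" unfolding W2_def
            by (rule grow) (use C fins in \<open>auto simp: W1_def\<close>)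
          moreover have "card W1 \<le> card D + k" unfolding W1_def
            by (rule grow) (use F finAB in auto)
          ultimately have W: "card W \<le> 5 * k + 1" using D_card m by simp
          have W_sub: "D \<subseteq> W" "sym_diff F A \<subseteq> W" "sym_diff C A \<subseteq> W" "sym_diff C' A \<subseteq> W"
            by (auto simp: W_def W2_def W1_def)
          have "\<not> core W P" for P
          proof
            assume P: "core W P"
            have finP: "finite P" using core_fin P by blast
            from witness[OF P W_sub(1)] obtain FP where FP: "FP \<in> \<F>"
              "\<And>X. sym_diff X A \<subseteq> D \<Longrightarrow> hamming FP X = hamming P X + k" by blast
            have neq: "P \<noteq> X" "P \<noteq> Z"
              using not_far[OF P C(1) W_sub(1,3)] not_far[OF P C'(1) W_sub(1,4)] C C' by blast+
            have "hamming Z P \<le> 1"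
              using core_dist[OF P F(1) W_sub(1,2)] F(2)[OF coreD[OF P]] m hamming_commute[of P F] by simp
            moreover have "hamming Z P \<noteq> 0" using neq(2) finX finP hamming_eq_0_iff by metis
            ultimately have ZP: "hamming Z P = 1" by linarith
            have "hamming X P \<noteq> 0" using neq(1) finX finP hamming_eq_0_iff by metis
            moreover have ev: "even (hamming X P)"
              using hamming_parity[of Z X P] finX finP ZX ZP by (simp del: One_nat_def)
            ultimately have "\<not> hamming X P \<le> 1" using odd_le_1[of "hamming X P"] by linarith
            then have "hamming P Y \<le> 1"
              using near[OF FP(1)] FP(2)[OF coreD[OF X]] FP(2)[OF coreD[OF Y]] hamming_commute[of P X] by simp
            moreover have "odd (hamming P Y)"
              using hamming_parity[of X P Y] finX finP ev XY by (simp del: One_nat_def)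
            ultimately have YP: "hamming Y P = 1"
              using hamming_commute[of P Y] odd_le_1 by metis
            have cyc: "hamming X A + hamming P A = hamming Y A + hamming Z A"
              using finX(1) finAB(1) XY YP
              by (rule hamming_four_cycle) (use ZX ZP hamming_commute[of Z X] neq \<open>Z \<noteq> Y\<close> in auto)
            have "odd (hamming X A + hamming Y A)" "odd (hamming X A + hamming Z A)"
              "odd (hamming Z A + hamming P A)"
              using hamming_parity[OF finX(1,2) finAB(1), unfolded XY]
                hamming_parity[OF finX(3,1) finAB(1), unfolded ZX]
                hamming_parity[OF finX(3) finP finAB(1), unfolded ZP] by presburger+
            moreover have lev: "hamming Q A = k \<or> hamming Q A = k + 1" if "core U Q" "D \<subseteq> U" for U Q
              using level[OF that] m by linarith
            ultimately show False
              using alternating_levels[OF lev[OF X sub'(1)] lev[OF Y sub'(2)] lev[OF Z sub'(3)] lev[OF P W_sub(1)]]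
                cyc by blast
          qed
          then show thesis using finish[of W] W W_sub(1) fins(3) by blast
        qed
        obtain C1 where C1: "C1 \<in> \<F>" "k + 2 \<le> hamming C1 P1"
          using far[of P1] core_fin[OF P1(1)] by blast
        define U2 where "U2 = D \<union> sym_diff C0 A"
        define U3 where "U3 = U2 \<union> sym_diff C1 A"
        have "finite U2" "D \<subseteq> U2" "card U2 \<le> m + k"
          using grow[OF C0(1), of D] finAB fin[OF C0(1)] D_card by (auto simp: U2_def)
        then have U3: "card U3 \<le> 5 * k + 1" "D \<subseteq> U3" "sym_diff C0 A \<subseteq> U3" "sym_diff C1 A \<subseteq> U3" "finite U3"
          using grow[OF C1(1), of U2] m fin[OF C1(1)] finAB(1) by (auto simp: U3_def U2_def)
        show thesis
        proof (cases "\<exists>P. core U3 P")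
          case False
          then show thesis using finish[of U3] U3 by blast
        next
          case True
          then obtain P2 where P2: "core U3 P2" by blast
          from witness[OF P2 U3(2)] obtain F2 where F2: "F2 \<in> \<F>"
            "\<And>X. sym_diff X A \<subseteq> D \<Longrightarrow> hamming F2 X = hamming P2 X + k" by blast
          have neq: "P2 \<noteq> P0" "P2 \<noteq> P1"
            using not_far[OF P2 C0(1) U3(2,3)] not_far[OF P2 C1(1) U3(2,4)] C0 C1 by blast+
          have finP2: "finite P2" using core_fin P2 by blast
          have pos: "hamming P2 P0 \<noteq> 0" "hamming P2 P1 \<noteq> 0"
            using neq finP finP2 hamming_eq_0_iff by metis+
          have P10: "hamming P1 P0 = 1" using P01 hamming_commute[of P0 P1] by simp
          \<comment> \<open>The witness of \<open>P2\<close> is \<open>k\<close> further away than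
            \<open>P2\<close> itself, so closeness to \<open>P0\<close> or \<open>P1\<close> within
            \<open>k + 1\<close> means adjacency of \<open>P2\<close>. The neighbour found takes the
            role of \<open>X\<close> in \<open>third\<close>.\<close>
          from near[OF F2(1)] have "hamming P2 P0 = 1 \<or> hamming P2 P1 = 1"
            using F2(2)[OF coreD[OF P0]] F2(2)[OF coreD[OF P1(1)]] pos by linarith
          then show thesis
          proof
            assume "hamming P2 P0 = 1"
            then show thesis using third[OF P0 P1(1) P2 _ U1(1) U3(2) P01] neq near by blast
          next
            assume "hamming P2 P1 = 1"
            then show thesis using third[OF P1(1) P0 P2 U1(1) _ U3(2) P10] neq near by blast
          qed
        qed
      qed
    qed
  qed
qed

section \<open>The Hilton--Milner theorem\<close>


definition uniform :: "'a set \<Rightarrow> nat \<Rightarrow> 'a set set \<Rightarrow> bool" where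
  "uniform V r \<F> \<longleftrightarrow> (\<forall>A\<in>\<F>. A \<subseteq> V \<and> card A = r)"

text \<open>The case \<open>A = B\<close> is included, so the empty set is never a member.\<close>

definition intersecting :: "'a set set \<Rightarrow> bool" where
  "intersecting \<F> \<longleftrightarrow> (\<forall>A\<in>\<F>. \<forall>B\<in>\<F>. A \<inter> B \<noteq> {})"

text \<open>The empty family does not qualify, since every \<open>v\<close> demands a
  member.\<close>

definition nontrivial :: "'a set set \<Rightarrow> bool" where
  "nontrivial \<F> \<longleftrightarrow> (\<forall>v. \<exists>A\<in>\<F>. v \<notin> A)"

section \<open>Compressions of set families\<close>

definition repl :: "'a \<Rightarrow> 'a \<Rightarrow> 'a set \<Rightarrow> 'a set" where
  "repl i j A = insert i (A - {j})"

definition movable :: "'a \<Rightarrow> 'a \<Rightarrow> 'a set set \<Rightarrow> 'a set set" where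
  "movable i j \<F> = {A \<in> \<F>. j \<in> A \<and> i \<notin> A \<and> repl i j A \<notin> \<F>}"

definition shift :: "'a \<Rightarrow> 'a \<Rightarrow> 'a set set \<Rightarrow> 'a set set" where
  "shift i j \<F> = (\<F> - movable i j \<F>) \<union> repl i j ` movable i j \<F>"

lemma shift_cases:
  assumes "A \<in> shift i j \<F>"
  obtains "A \<in> \<F>" "A \<notin> movable i j \<F>" | B where "B \<in> movable i j \<F>" "A = repl i j B"
  using assms by (auto simp: shift_def)

lemma inj_on_repl_movable: "inj_on (repl i j) (movable i j \<F>)"
  by (rule inj_on_inverseI[of _ "\<lambda>A. insert j (A - {i})"]) (auto simp: movable_def repl_def)

lemma card_shift:
  assumes "finite \<F>"
  shows "card (shift i j \<F>) = card \<F>"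
proof -
  have "movable i j \<F> \<subseteq> \<F>" by (auto simp: movable_def)
  moreover have "(\<F> - movable i j \<F>) \<inter> repl i j ` movable i j \<F> = {}" by (auto simp: movable_def)
  ultimately show ?thesis
    using assms card_mono[of \<F> "movable i j \<F>"] unfolding shift_def
    by (subst card_Un_disjoint)
      (auto simp: card_Diff_subset finite_subset card_image[OF inj_on_repl_movable])
qed

lemma uniform_shift:
  assumes "uniform V r \<F>" "i \<in> V" "finite V"
  shows "uniform V r (shift i j \<F>)"
  unfolding uniform_def
proof (rule ballI)
  fix A assume "A \<in> shift i j \<F>"
  then show "A \<subseteq> V \<and> card A = r"
  proof (cases rule: shift_cases)
    case (2 B)
    then have B: "B \<subseteq> V" "card B = r" "j \<in> B" "i \<notin> B" using assms by (auto simp: movable_def uniform_def)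
    then have "finite B" "0 < card B" using assms card_gt_0_iff by (auto intro: finite_subset)
    then show ?thesis using B 2 assms by (auto simp: repl_def)
  qed (use assms in \<open>auto simp: uniform_def\<close>)
qed

text \<open>The critical pair is a moved \<open>A\<close> and an unmoved \<open>B\<close> containing
  \<open>j\<close> but not \<open>i\<close>. Such a \<open>B\<close> stayed because
  \<open>repl i j B\<close> is already a member. It meets \<open>A\<close> in a point other than
  \<open>i\<close> and \<open>j\<close>, which the compression of \<open>A\<close> keeps.\<close>

lemma intersecting_shift:
  assumes "intersecting \<F>"
  shows "intersecting (shift i j \<F>)"
proof -
  have mixed: "repl i j A \<inter> B \<noteq> {}"
    if A: "A \<in> movable i j \<F>" and B: "B \<in> \<F>" "B \<notin> movable i j \<F>" for A B
  proof (cases "i \<in> B \<or> j \<notin> B")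
    case True
    then show ?thesis using A B assms unfolding movable_def intersecting_def repl_def by blast
  next
    case False
    then have "repl i j B \<in> \<F>" using B by (auto simp: movable_def)
    then have "A \<inter> repl i j B \<noteq> {}" using A assms by (auto simp: movable_def intersecting_def)
    then show ?thesis using A by (auto simp: movable_def repl_def)
  qed
  show ?thesis unfolding intersecting_def
  proof (intro ballI)
    fix A B assume "A \<in> shift i j \<F>" "B \<in> shift i j \<F>"
    then show "A \<inter> B \<noteq> {}"
      using assms mixed unfolding intersecting_def
      by (elim shift_cases) (auto simp: Int_commute, auto simp: repl_def)
  qed
qed

definition stable :: "nat set \<Rightarrow> nat set set \<Rightarrow> bool" where
  "stable W \<F> \<longleftrightarrow> (\<forall>i\<in>W. \<forall>j\<in>W. i < j \<longrightarrow> movable i j \<F> = {})"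

lemma sum_weight_shift_less:
  assumes "finite \<F>" "\<forall>A\<in>\<F>. finite A" "i < j" "movable i j \<F> \<noteq> {}"
  shows "(\<Sum>A\<in>shift i j \<F>. \<Sum>A) < (\<Sum>A\<in>\<F>. \<Sum>(A :: nat set))"
proof -
  let ?M = "movable i j \<F>"
  have M: "?M \<subseteq> \<F>" "finite ?M" using assms by (auto simp: movable_def)
  have "(\<Sum>A\<in>shift i j \<F>. \<Sum>A) = (\<Sum>A\<in>\<F> - ?M. \<Sum>A) + (\<Sum>A\<in>repl i j ` ?M. \<Sum>A)"
    unfolding shift_def using M assms(1) by (intro sum.union_disjoint) (auto simp: movable_def)
  also have "(\<Sum>A\<in>repl i j ` ?M. \<Sum>A) = (\<Sum>A\<in>?M. \<Sum>(repl i j A))"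
    by (simp add: sum.reindex[OF inj_on_repl_movable])
  also have "\<dots> < (\<Sum>A\<in>?M. \<Sum>A)"
  proof (rule sum_strict_mono)
    fix A assume A: "A \<in> ?M"
    then have "finite A" "j \<in> A" "i \<notin> A" using assms by (auto simp: movable_def)
    then show "\<Sum>(repl i j A) < \<Sum>A"
      using assms(3) sum.remove[of A j "\<lambda>x. x"] by (simp add: repl_def)
  qed (use M assms in auto)
  also have "(\<Sum>A\<in>\<F> - ?M. \<Sum>A) + (\<Sum>A\<in>?M. \<Sum>A) = (\<Sum>A\<in>\<F>. \<Sum>A)"
    using M assms(1) by (simp add: sum.subset_diff)
  finally show ?thesis by simp
qed

text \<open>An effective compression lowers the total of all elements, so a family of least total
  within \<open>C\<close> works. The property \<open>C\<close> is left open because it is used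
  twice, with different families to be preserved.\<close>

lemma exists_stable_or_leaving:
  assumes "C \<F>"
    and "\<And>\<G>. C \<G> \<Longrightarrow> finite \<G> \<and> (\<forall>A\<in>\<G>. finite A)"
  shows "\<exists>\<G>. C \<G> \<and> (stable W \<G> \<or> (\<exists>i\<in>W. \<exists>j\<in>W. i < j \<and> \<not> C (shift i j \<G>)))"
proof -
  from ex_has_least_nat[of C \<F> "\<lambda>\<G>. \<Sum>A\<in>\<G>. \<Sum>A", OF assms(1)] obtain \<G> where
    \<G>: "C \<G>" "\<And>\<H>. C \<H> \<Longrightarrow> (\<Sum>A\<in>\<G>. \<Sum>A) \<le> (\<Sum>A\<in>\<H>. \<Sum>A)" by blast
  have "movable i j \<G> = {}" if "i < j" "C (shift i j \<G>)" for i j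
    using \<G>(2)[OF that(2)] sum_weight_shift_less[of \<G> i j] assms(2)[OF \<G>(1)] that(1) by fastforce
  then show ?thesis using \<G>(1) unfolding stable_def by blast
qed

lemma exists_initial_segment:
  fixes W :: "nat set"
  assumes "finite W" "m \<le> card W"
  shows "\<exists>I\<subseteq>W. card I = m \<and> (\<forall>i\<in>I. \<forall>j\<in>W - I. i < j)"
  using assms(2)
proof (induction m)
  case 0
  then show ?case by (intro exI[of _ "{}"]) auto
next
  case (Suc m)
  then obtain I where I: "I \<subseteq> W" "card I = m" "\<forall>i\<in>I. \<forall>j\<in>W - I. i < j" by auto
  then have fin: "finite I" "W - I \<noteq> {}" using Suc.prems assms(1) by (auto intro: finite_subset)
  define x where "x = Min (W - I)"
  have x: "x \<in> W - I" "\<And>y. y \<in> W - I \<Longrightarrow> x \<le> y"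
    using fin assms(1) by (simp_all add: x_def del: Diff_iff)
  have "card (insert x I) = Suc m" using x fin I by simp
  moreover have "\<forall>i\<in>insert x I. \<forall>j\<in>W - insert x I. i < j"
    using I(3) x by (auto simp: le_less)
  ultimately show ?case using I(1) x(1) by (intro exI[of _ "insert x I"]) auto
qed

text \<open>Replacing a common element outside \<open>P \<union> I\<close> by an element of \<open>I\<close> missed by both sets shrinks
  an intersection avoiding \<open>P \<union> I\<close>, so a pair with smallest such intersection cannot exist.\<close>

lemma stable_traces_intersect:
  assumes V: "finite V" and unif: "uniform V r \<F>" and int: "intersecting \<F>"
    and st: "stable (V - P) \<F>" and I: "I \<subseteq> V - P" "\<forall>i\<in>I. \<forall>j\<in>V - P - I. i < j"
    and cardI: "\<And>A B j. A \<in> \<F> \<Longrightarrow> B \<in> \<F> \<Longrightarrow> A \<inter> B \<inter> (P \<union> I) = {} \<Longrightarrow> j \<in> A \<inter> B \<Longrightarrow>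
        card (A \<inter> I) + card (B \<inter> I) < card I"
    and "A \<in> \<F>" "B \<in> \<F>"
  shows "A \<inter> B \<inter> (P \<union> I) \<noteq> {}"
  using \<open>A \<in> \<F>\<close>
proof (induction "card (A \<inter> B)" arbitrary: A rule: less_induct)
  case less
  show ?case
  proof
    assume empty: "A \<inter> B \<inter> (P \<union> I) = {}"
    obtain j where j: "j \<in> A \<inter> B" using int less.prems \<open>B \<in> \<F>\<close> unfolding intersecting_def by blast
    have finI: "finite I" using V I(1) by (meson finite_Diff finite_subset)
    have "card ((A \<union> B) \<inter> I) < card I"
      using cardI[OF less.prems \<open>B \<in> \<F>\<close> empty j] card_Un_le[of "A \<inter> I" "B \<inter> I"]
      by (simp add: Int_Un_distrib2)
    then have "\<not> I \<subseteq> A \<union> B" using finI by (metis Int_absorb1 less_irrefl)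
    then obtain i where i: "i \<in> I" "i \<notin> A" "i \<notin> B" by blast
    have AV: "A \<subseteq> V" using unif less.prems by (auto simp: uniform_def)
    then have jVP: "j \<in> V - P - I" using j empty by blast
    have "i < j" using I(2) i(1) jVP by blast
    moreover have "i \<in> V - P" using i(1) I(1) by blast
    ultimately have "movable i j \<F> = {}" using st jVP unfolding stable_def by blast
    then have in_F: "repl i j A \<in> \<F>" using less.prems j i by (auto simp: movable_def)
    have eq: "repl i j A \<inter> B = A \<inter> B - {j}" using i by (auto simp: repl_def)
    have "finite (A \<inter> B)" using AV V by (meson finite_Int finite_subset)
    then have "card (repl i j A \<inter> B) < card (A \<inter> B)"
      unfolding eq using j by (rule card_Diff1_less)
    from less.hyps[OF this in_F] show False using eq empty by blast
  qed
qed

section \<open>Counting by traces on a fixed set\<close>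

lemma card_uniform_trace_le:
  assumes V: "finite V" "X \<subseteq> V" and unif: "uniform V r \<F>"
  shows "card \<F> \<le> (\<Sum>i\<le>r. card {B \<in> (\<lambda>A. A \<inter> X) ` \<F>. card B = i} * ((card V - card X) choose (r - i)))"
proof -
  define tr where "tr i = {B \<in> (\<lambda>A. A \<inter> X) ` \<F>. card B = i}" for i
  define ext where "ext i = {C. C \<subseteq> V - X \<and> card C = r - i}" for i
  have fin: "finite \<F>" using V unif by (auto simp: uniform_def intro: finite_subset[of _ "Pow V"])
  have finX: "finite X" using V finite_subset by blast
  have "inj_on (\<lambda>A. (A \<inter> X, A - X)) \<F>" by (rule inj_onI) blast
  moreover have "(\<lambda>A. (A \<inter> X, A - X)) ` \<F> \<subseteq> (\<Union>i\<in>{..r}. tr i \<times> ext i)"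
  proof
    fix p assume "p \<in> (\<lambda>A. (A \<inter> X, A - X)) ` \<F>"
    then obtain A where A: "A \<in> \<F>" "p = (A \<inter> X, A - X)" by blast
    then have AV: "A \<subseteq> V" "card A = r" using unif by (auto simp: uniform_def)
    then have finA: "finite A" using V finite_subset by blast
    have "card A = card (A \<inter> X) + card (A - X)" using card_Int_Diff[OF finA] .
    then have "card (A - X) = r - card (A \<inter> X)" "card (A \<inter> X) \<le> r" using AV by auto
    then show "p \<in> (\<Union>i\<in>{..r}. tr i \<times> ext i)" using A AV by (auto simp: tr_def ext_def)
  qed
  moreover have fins: "finite (tr i)" "finite (ext i)" for i
    using fin V by (auto simp: tr_def ext_def)
  ultimately have "card \<F> \<le> card (\<Union>i\<in>{..r}. tr i \<times> ext i)"
    by (intro card_inj_on_le) auto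
  also have "\<dots> \<le> (\<Sum>i\<le>r. card (tr i \<times> ext i))" by (rule card_UN_le) simp
  also have "\<dots> = (\<Sum>i\<le>r. card (tr i) * ((card V - card X) choose (r - i)))"
  proof (rule sum.cong)
    fix i
    have "card (ext i) = (card (V - X)) choose (r - i)"
      unfolding ext_def using V by (intro n_subsets) auto
    then show "card (tr i \<times> ext i) = card (tr i) * ((card V - card X) choose (r - i))"
      using V finX by (simp add: card_cartesian_product card_Diff_subset)
  qed simp
  finally show ?thesis by (simp add: tr_def)
qed

text \<open>A set and its complement are never both members, so at most half of the central binomial
  coefficient is reached.\<close>

lemma card_intersecting_half_le:
  assumes "finite X" "card X = 2 * r" "0 < r" "uniform X r \<F>" "intersecting \<F>"
  shows "card \<F> \<le> (2 * r - 1) choose (r - 1)"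
proof -
  let ?c = "\<lambda>A. X - A"
  have sub: "\<F> \<subseteq> {A. A \<subseteq> X \<and> card A = r}" using assms by (auto simp: uniform_def)
  have fin: "finite {A. A \<subseteq> X \<and> card A = r}" using assms by simp
  have csub: "?c ` \<F> \<subseteq> {A. A \<subseteq> X \<and> card A = r}"
    using sub assms by (auto simp: card_Diff_subset finite_subset)
  have "inj_on ?c \<F>" using sub by (intro inj_onI) blast
  then have "card (?c ` \<F>) = card \<F>" by (rule card_image)
  moreover have "\<F> \<inter> ?c ` \<F> = {}" using assms(5) unfolding intersecting_def by blast
  ultimately have "2 * card \<F> = card (\<F> \<union> ?c ` \<F>)"
    using finite_subset[OF sub fin] by (simp add: card_Un_disjoint)
  also have "\<dots> \<le> card {A. A \<subseteq> X \<and> card A = r}" using sub csub fin by (intro card_mono) auto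
  also have "\<dots> = (2 * r) choose r" using assms by (simp add: n_subsets)
  also have "\<dots> = 2 * ((2 * r - 1) choose (r - 1))"
  proof -
    have "(2 * r) choose r = ((2 * r - 1) choose (r - 1)) + ((2 * r - 1) choose r)"
      using choose_reduce_nat[of "2 * r" r] assms(3) by simp
    moreover have "(2 * r - 1) choose r = (2 * r - 1) choose (r - 1)"
      using binomial_symmetric[of r "2 * r - 1"] assms(3) by (simp add: mult_2)
    ultimately show ?thesis by simp
  qed
  finally show ?thesis by simp
qed

text \<open>Among the \<open>i\<close>-sets through \<open>v\<close>, those missing \<open>G\<close>
  are lost; the binomial coefficient on the left counts them.\<close>

lemma card_star_meeting_le:
  assumes X: "finite X" "uniform X i \<T>" "0 < i"
    and v: "v \<in> X" "\<And>A. A \<in> \<T> \<Longrightarrow> v \<in> A"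
    and G: "G \<subseteq> X" "v \<notin> G" "\<And>A. A \<in> \<T> \<Longrightarrow> A \<inter> G \<noteq> {}"
  shows "card \<T> + ((card X - 1 - card G) choose (i - 1)) \<le> (card X - 1) choose (i - 1)"
proof -
  let ?S = "\<lambda>Y. {B. B \<subseteq> Y \<and> card B = i - 1}"
  let ?Y = "X - {v}"
  have finT: "finite \<T>" using X by (auto simp: uniform_def intro: finite_subset[of _ "Pow X"])
  have "inj_on (\<lambda>A. A - {v}) \<T>" using v(2) by (intro inj_onI) blast
  then have "card \<T> = card ((\<lambda>A. A - {v}) ` \<T>)" by (simp add: card_image)
  moreover have disj: "(\<lambda>A. A - {v}) ` \<T> \<inter> ?S (?Y - G) = {}"
    using G(2,3) by blast
  moreover have "card (?S (?Y - G)) = (card X - 1 - card G) choose (i - 1)"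
  proof -
    have "card (?Y - G) = card X - 1 - card G"
      using X G v by (subst card_Diff_subset) (auto intro: finite_subset)
    then show ?thesis using X by (simp add: n_subsets)
  qed
  moreover have fin: "finite (?S (?Y - G))" using X by simp
  ultimately have "card \<T> + ((card X - 1 - card G) choose (i - 1))
      = card ((\<lambda>A. A - {v}) ` \<T> \<union> ?S (?Y - G))"
    using finT card_Un_disjoint[OF finite_imageI[OF finT] fin disj] by simp
  also have "\<dots> \<le> card (?S ?Y)"
  proof (rule card_mono)
    have "A - {v} \<in> ?S ?Y" if "A \<in> \<T>" for A
      using that X v by (auto simp: uniform_def finite_subset)
    then show "(\<lambda>A. A - {v}) ` \<T> \<union> ?S (?Y - G) \<subseteq> ?S ?Y" by auto
  qed (use X in simp)
  also have "\<dots> = (card X - 1) choose (i - 1)"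
    using X v by (simp add: n_subsets)
  finally show ?thesis .
qed


text \<open>If a shift makes a nontrivial family trivial, then all members meet \<open>{i, j}\<close>.  Adding all
  sets containing \<open>{i, j}\<close> makes nontriviality persist under shifts within the remaining points.\<close>

lemma exists_trace_set:
  fixes V :: "nat set"
  assumes V: "finite V" "2 * r \<le> card V"
    and F: "uniform V r \<F>" "intersecting \<F>" "nontrivial \<F>"
  obtains \<G> X where "uniform V r \<G>" "intersecting \<G>" "nontrivial \<G>" "card \<F> \<le> card \<G>"
    "X \<subseteq> V" "card X = 2 * r" "\<And>A B. A \<in> \<G> \<Longrightarrow> B \<in> \<G> \<Longrightarrow> A \<inter> B \<inter> X \<noteq> {}"
proof -
  have finU: "finite \<G> \<and> (\<forall>A\<in>\<G>. finite A)" if "uniform V r \<G>" for \<G>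
    using that V by (auto simp: uniform_def intro: finite_subset[of _ "Pow V"] finite_subset)
  define C where "C \<G> \<longleftrightarrow> uniform V r \<G> \<and> intersecting \<G> \<and> nontrivial \<G> \<and> card \<G> = card \<F>" for \<G>
  have "C \<F>" using F by (simp add: C_def)
  then have "\<exists>\<G>. C \<G> \<and> (stable V \<G> \<or> (\<exists>i\<in>V. \<exists>j\<in>V. i < j \<and> \<not> C (shift i j \<G>)))"
    by (rule exists_stable_or_leaving) (use finU in \<open>auto simp: C_def\<close>)
  then obtain \<G> where G: "C \<G>" and alt: "stable V \<G> \<or> (\<exists>i\<in>V. \<exists>j\<in>V. i < j \<and> \<not> C (shift i j \<G>))"
    by blast
  from G have G': "uniform V r \<G>" "intersecting \<G>" "nontrivial \<G>" "card \<G> = card \<F>"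
    by (auto simp: C_def)
  from alt show thesis
  proof
    assume st: "stable V \<G>"
    from exists_initial_segment[OF V] obtain I where
      I: "I \<subseteq> V" "card I = 2 * r" "\<forall>i\<in>I. \<forall>j\<in>V - I. i < j" by blast
    \<comment> \<open>A member with a point outside \<open>I\<close> has at most
      \<open>r - 1\<close> points inside, so two such members leave a point of \<open>I\<close>
      uncovered.\<close>
    have small: "card (A \<inter> I) \<le> r - 1" if "A \<in> \<G>" "j \<in> A" "j \<notin> I" for A j
    proof -
      have "finite A" "card A = r" using finU[OF G'(1)] G'(1) that by (auto simp: uniform_def)
      moreover from this have "card (A \<inter> I) \<le> card (A - {j})" using that by (intro card_mono) auto
      ultimately show ?thesis using that by simp
    qed
    have "A \<inter> B \<inter> ({} \<union> I) \<noteq> {}" if AB: "A \<in> \<G>" "B \<in> \<G>" for A B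
    proof (rule stable_traces_intersect[OF V(1) G'(1,2)])
      fix A B j assume *: "A \<in> \<G>" "B \<in> \<G>" "A \<inter> B \<inter> ({} \<union> I) = {}" "j \<in> A \<inter> B"
      have "finite A" "card A = r" using finU[OF G'(1)] G'(1) * by (auto simp: uniform_def)
      then have "0 < r" using *(4) card_gt_0_iff by blast
      moreover have "card (A \<inter> I) \<le> r - 1" "card (B \<inter> I) \<le> r - 1" using small * by blast+
      ultimately show "card (A \<inter> I) + card (B \<inter> I) < card I" using I(2) by linarith
    qed (use st I AB in auto)
    then show thesis using that[OF G'(1-3) _ I(1,2)] G'(4) by simp
  next
    assume "\<exists>i\<in>V. \<exists>j\<in>V. i < j \<and> \<not> C (shift i j \<G>)"
    then obtain i j where ij: "i \<in> V" "j \<in> V" "i < j" "\<not> C (shift i j \<G>)" by blast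
    have "card (shift i j \<G>) = card \<F>" using card_shift[of \<G>] finU[OF G'(1)] G'(4) by simp
    then have "\<not> nontrivial (shift i j \<G>)"
      using ij(4) uniform_shift[OF G'(1) ij(1) V(1)] intersecting_shift[OF G'(2)]
      unfolding C_def by blast
    then obtain v where v: "\<And>A. A \<in> shift i j \<G> \<Longrightarrow> v \<in> A" by (auto simp: nontrivial_def)
    have star: "v \<in> A" if "A \<in> \<G>" "A \<notin> movable i j \<G>" for A
      using v that by (auto simp: shift_def)
    have star': "v \<in> repl i j A" if "A \<in> movable i j \<G>" for A
      using v that by (auto simp: shift_def)
    \<comment> \<open>A compression introduces no point except \<open>i\<close>, so any other common
      point would have been common before.\<close>
    have "v = i"
    proof (rule ccontr)
      assume "v \<noteq> i"
      then have "v \<in> A" if "A \<in> \<G>" for A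
        using star[OF that] star'[of A] by (auto simp: repl_def)
      then show False using G'(3) by (auto simp: nontrivial_def)
    qed
    then have meet: "i \<in> A \<or> j \<in> A" if "A \<in> \<G>" for A
      using star[OF that] by (auto simp: movable_def)
    define E where "E = {A. A \<subseteq> V \<and> card A = r \<and> i \<in> A \<and> j \<in> A}"
    \<comment> \<open>Nontriviality is stored in a form that compressions fixing \<open>i\<close>
      and \<open>j\<close> visibly keep: one member misses \<open>i\<close>, one misses
      \<open>j\<close>, and \<open>E\<close> contains, for every other point, a set avoiding
      it.\<close>
    define C' where "C' \<H> \<longleftrightarrow> uniform V r \<H> \<and> intersecting \<H> \<and> E \<subseteq> \<H> \<and> (\<forall>A\<in>\<H>. i \<in> A \<or> j \<in> A) \<and>
        (\<exists>A\<in>\<H>. i \<notin> A) \<and> (\<exists>A\<in>\<H>. j \<notin> A) \<and> card \<H> = card (\<G> \<union> E)" for \<H>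
    have "C' (\<G> \<union> E)"
    proof -
      have "uniform V r (\<G> \<union> E)" using G'(1) by (auto simp: uniform_def E_def)
      moreover have "intersecting (\<G> \<union> E)"
        using G'(2) meet unfolding intersecting_def E_def by blast
      ultimately show ?thesis using meet G'(3) by (auto simp: C'_def nontrivial_def E_def)
    qed
    then have "\<exists>\<H>. C' \<H> \<and> (stable (V - {i, j}) \<H> \<or>
        (\<exists>a\<in>V - {i, j}. \<exists>b\<in>V - {i, j}. a < b \<and> \<not> C' (shift a b \<H>)))"
      by (rule exists_stable_or_leaving) (use finU in \<open>auto simp: C'_def\<close>)
    moreover have "C' (shift a b \<H>)" if H: "C' \<H>" and ab: "a \<in> V - {i, j}" "b \<in> V - {i, j}" for \<H> a b
    proof -
      have fixed: "i \<in> repl a b A \<longleftrightarrow> i \<in> A" "j \<in> repl a b A \<longleftrightarrow> j \<in> A" for A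
        using ab by (auto simp: repl_def)
      have shift_mem: "A \<in> shift a b \<H> \<or> repl a b A \<in> shift a b \<H>" if "A \<in> \<H>" for A
        using that by (auto simp: shift_def)
      have "E \<subseteq> shift a b \<H>"
      proof
        fix A assume A: "A \<in> E"
        have "A \<notin> movable a b \<H>"
        proof
          assume M: "A \<in> movable a b \<H>"
          then have "repl a b A \<in> shift a b \<H>" by (auto simp: shift_def)
          moreover have "uniform V r (shift a b \<H>)"
            using uniform_shift[of V r \<H> a b] H ab V by (simp add: C'_def)
          ultimately have "repl a b A \<in> E" using A fixed by (auto simp: E_def uniform_def)
          then show False using M H by (auto simp: movable_def C'_def)
        qed
        then show "A \<in> shift a b \<H>" using A H by (auto simp: shift_def C'_def)
      qed
      moreover have "\<forall>A\<in>shift a b \<H>. i \<in> A \<or> j \<in> A"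
      proof
        fix A assume "A \<in> shift a b \<H>"
        then obtain B where "B \<in> \<H>" "A = B \<or> A = repl a b B" by (auto simp: shift_def movable_def)
        then show "i \<in> A \<or> j \<in> A" using H fixed[of B] by (auto simp: C'_def)
      qed
      moreover have "\<exists>A\<in>shift a b \<H>. i \<notin> A" "\<exists>A\<in>shift a b \<H>. j \<notin> A"
      proof -
        obtain A1 A2 where "A1 \<in> \<H>" "i \<notin> A1" "A2 \<in> \<H>" "j \<notin> A2" using H by (auto simp: C'_def)
        then show "\<exists>A\<in>shift a b \<H>. i \<notin> A" "\<exists>A\<in>shift a b \<H>. j \<notin> A"
          using shift_mem fixed by blast+
      qed
      moreover have "finite \<H>" using H finU by (auto simp: C'_def)
      ultimately show ?thesis
        using H ab V card_shift[of \<H> a b] uniform_shift[of V r \<H> a b] intersecting_shift[of \<H> a b]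
        unfolding C'_def by simp
    qed
    ultimately obtain \<H> where H: "C' \<H>" and st: "stable (V - {i, j}) \<H>" by blast
    from H have H': "uniform V r \<H>" "intersecting \<H>" "E \<subseteq> \<H>" "card \<H> = card (\<G> \<union> E)"
      and meet': "\<And>A. A \<in> \<H> \<Longrightarrow> i \<in> A \<or> j \<in> A"
      by (auto simp: C'_def)
    from H obtain A1 A2 where A12: "A1 \<in> \<H>" "i \<notin> A1" "A2 \<in> \<H>" "j \<notin> A2" by (auto simp: C'_def)
    have finH: "finite A" "card A = r" if "A \<in> \<H>" for A
      using finU[OF H'(1)] H'(1) that by (auto simp: uniform_def)
    have r2: "2 \<le> r"
    proof -
      obtain x where "x \<in> A1" "x \<in> A2" using H'(2) A12 unfolding intersecting_def by blast
      then have "{j, x} \<subseteq> A1" "j \<noteq> x" using meet' A12 by auto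
      then show ?thesis using finH[OF A12(1)] card_mono[of A1 "{j, x}"] by simp
    qed
    have cardW: "card (V - {i, j}) = card V - 2" using ij V by (simp add: card_Diff_subset)
    have nt: "nontrivial \<H>" unfolding nontrivial_def
    proof
      fix v
      show "\<exists>A\<in>\<H>. v \<notin> A"
      proof (cases "v = i \<or> v = j")
        case True
        then show ?thesis using A12 by blast
      next
        case False
        have "card V - 3 \<le> card (V - {i, j} - {v})"
          using cardW by (cases "v \<in> V - {i, j}") (simp_all add: card_Diff_singleton_if)
        then have "r - 2 \<le> card (V - {i, j} - {v})" using V(2) r2 by linarith
        then obtain B where B: "B \<subseteq> V - {i, j} - {v}" "card B = r - 2" "finite B"
          by (rule obtain_subset_with_card_n)
        then have "i \<notin> insert j B" "j \<notin> B" using ij(3) by auto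
        then have "card (insert i (insert j B)) = r" using B r2 by simp
        then have "insert i (insert j B) \<in> E" using B(1) ij(1,2) by (auto simp: E_def)
        then have "insert i (insert j B) \<in> \<H>" using H'(3) by (rule rev_subsetD)
        moreover have "v \<notin> insert i (insert j B)" using B(1) False by auto
        ultimately show ?thesis by (rule bexI[rotated])
      qed
    qed
    have "2 * r - 2 \<le> card (V - {i, j})" using cardW V(2) by simp
    from exists_initial_segment[OF finite_Diff[OF V(1)] this] obtain I where
      I: "I \<subseteq> V - {i, j}" "card I = 2 * r - 2" "\<forall>a\<in>I. \<forall>b\<in>V - {i, j} - I. a < b" by blast
    \<comment> \<open>One point of \<open>A\<close> lies in \<open>{i, j}\<close> and one is
      \<open>l\<close>. The two points given up in \<open>I\<close> for \<open>i\<close> and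
      \<open>j\<close> are thereby recovered.\<close>
    have small: "card (A \<inter> I) \<le> r - 2" if A: "A \<in> \<H>" "l \<in> A" "l \<notin> {i, j} \<union> I" for A l
    proof -
      obtain p where p: "p \<in> A" "p \<in> {i, j}" using meet'[OF A(1)] by blast
      have "A \<inter> I \<subseteq> A - {l, p}" using A p I by auto
      then have "card (A \<inter> I) \<le> card (A - {l, p})" using finH[OF A(1)] by (intro card_mono) auto
      also have "\<dots> = r - 2" using finH[OF A(1)] A p by (subst card_Diff_subset) auto
      finally show ?thesis .
    qed
    have "A \<inter> B \<inter> ({i, j} \<union> I) \<noteq> {}" if AB: "A \<in> \<H>" "B \<in> \<H>" for A B
    proof (rule stable_traces_intersect[OF V(1) H'(1,2) st I(1,3)])
      fix A B l assume *: "A \<in> \<H>" "B \<in> \<H>" "A \<inter> B \<inter> ({i, j} \<union> I) = {}" "l \<in> A \<inter> B"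
      have "card (A \<inter> I) \<le> r - 2" "card (B \<inter> I) \<le> r - 2" using small * by blast+
      then show "card (A \<inter> I) + card (B \<inter> I) < card I" using I(2) r2 by linarith
    qed (use AB in auto)
    moreover have "card ({i, j} \<union> I) = 2 * r"
    proof -
      have "finite I" using I(1) V(1) by (meson finite_Diff finite_subset)
      then have "card ({i, j} \<union> I) = card {i, j} + card I"
        using I(1) by (intro card_Un_disjoint) auto
      then show ?thesis using ij(3) I(2) r2 by simp
    qed
    moreover have "card \<F> \<le> card \<H>"
    proof -
      have "finite (\<G> \<union> E)" using finU[OF G'(1)] V by (simp add: E_def)
      then show ?thesis using card_mono[of "\<G> \<union> E" \<G>] G'(4) H'(4) by simp
    qed
    moreover have "{i, j} \<union> I \<subseteq> V" using I(1) ij(1,2) by blast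
    ultimately show thesis using that[OF H'(1,2) nt] by blast
  qed
qed

lemma nontrivial_intersecting_uniform_ge_2:
  assumes "finite V" "uniform V r \<F>" "intersecting \<F>" "nontrivial \<F>"
  shows "2 \<le> r"
proof -
  obtain A where A: "A \<in> \<F>" using assms(4) by (auto simp: nontrivial_def)
  then have "A \<inter> A \<noteq> {}" using assms(3) unfolding intersecting_def by blast
  then obtain x where x: "x \<in> A" by blast
  obtain B where B: "B \<in> \<F>" "x \<notin> B" using assms(4) by (auto simp: nontrivial_def)
  obtain y where y: "y \<in> A" "y \<in> B" using A B(1) assms(3) unfolding intersecting_def by blast
  have "finite A" "card A = r" using A assms(1,2) by (auto simp: uniform_def intro: finite_subset)
  moreover have "{x, y} \<subseteq> A" "x \<noteq> y" using x y B by auto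
  ultimately show ?thesis using card_mono[of A "{x, y}"] by simp
qed

text \<open>With \<open>s = r - 1\<close>, the traces of size \<open>l + 1\<close> below
  \<open>r\<close> fall short of the star bound \<open>(2 * r - 1) choose l\<close> by at least
  \<open>s choose l\<close>. For size \<open>r\<close> complementation gives the star bound without
  the defect \<open>s choose s\<close>, which accounts for the final \<open>+ 1\<close>. Weighted by
  the number of extensions outside \<open>X\<close>, star bounds and defects each add up to one
  binomial coefficient by Vandermonde's identity.\<close>

theorem Hilton_Milner:
  fixes V :: "nat set"
  assumes "finite V" "2 * r \<le> card V" "uniform V r \<F>" "intersecting \<F>" "nontrivial \<F>"
  shows "card \<F> + ((card V - r - 1) choose (r - 1)) \<le> ((card V - 1) choose (r - 1)) + 1"
  using assms
proof (induction r arbitrary: V \<F> rule: less_induct)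
  case (less r)
  have r2: "2 \<le> r" by (rule nontrivial_intersecting_uniform_ge_2) fact+
  from exists_trace_set[OF less.prems] obtain \<G> X where
    G: "uniform V r \<G>" "intersecting \<G>" "nontrivial \<G>" "card \<F> \<le> card \<G>"
    and X: "X \<subseteq> V" "card X = 2 * r" "\<And>A B. A \<in> \<G> \<Longrightarrow> B \<in> \<G> \<Longrightarrow> A \<inter> B \<inter> X \<noteq> {}" by blast
  have finX: "finite X" using X(1) less.prems(1) by (rule finite_subset)
  define T where "T i = {B \<in> (\<lambda>A. A \<inter> X) ` \<G>. card B = i}" for i
  have T: "uniform X i (T i)" "intersecting (T i)" for i
    using X(3) by (auto simp: T_def uniform_def intersecting_def Int_ac)
  define s where "s = r - 1"
  have T_bound: "card (T (Suc l)) + (s choose l) \<le> (2 * r - 1) choose l" if l: "l < s" for l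
  proof (cases "nontrivial (T (Suc l))")
    case True
    have l1: "1 \<le> l" using nontrivial_intersecting_uniform_ge_2[OF finX T True] by simp
    have "card (T (Suc l)) + ((card X - Suc l - 1) choose (Suc l - 1)) \<le> ((card X - 1) choose (Suc l - 1)) + 1"
      by (rule less.IH) (use l X T finX True in \<open>auto simp: s_def\<close>)
    \<comment> \<open>The induction hypothesis exceeds the wanted bound by 1, and the slack
      \<open>s choose (l - 1)\<close> pays for it.\<close>
    moreover have "(s choose l) + 1 \<le> (2 * r - Suc l - 1) choose l"
    proof -
      have "(s choose l) + 1 \<le> (s choose l) + (s choose (l - 1))"
        using l by (simp add: Suc_le_eq)
      also have "\<dots> = Suc s choose l" using l1 choose_reduce_nat[of "Suc s" l] by simp
      also have "\<dots> \<le> (2 * r - Suc l - 1) choose l"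
        using l r2 by (intro binomial_right_mono) (auto simp: s_def)
      finally show ?thesis .
    qed
    ultimately show ?thesis using X(2) by simp
  next
    case False
    then obtain v where v: "\<And>B. B \<in> T (Suc l) \<Longrightarrow> v \<in> B" by (auto simp: nontrivial_def)
    show ?thesis
    proof (cases "T (Suc l) = {}")
      case True
      then show ?thesis using r2 by (auto simp: s_def intro!: binomial_right_mono)
    next
      case False
      then have vX: "v \<in> X" using v T(1)[of "Suc l"] by (auto simp: uniform_def)
      \<comment> \<open>The traces form a star at \<open>v\<close>, but some member misses
        \<open>v\<close>. Its trace has at most \<open>r\<close> points and meets all traces of the
        star.\<close>
      obtain A where A: "A \<in> \<G>" "v \<notin> A" using G(3) by (auto simp: nontrivial_def)
      have finA: "finite A" "card A = r"
        using A G(1) less.prems(1) by (auto simp: uniform_def intro: finite_subset)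
      have "card (T (Suc l)) + ((card X - 1 - card (A \<inter> X)) choose (Suc l - 1)) \<le> (card X - 1) choose (Suc l - 1)"
      proof (rule card_star_meeting_le[OF finX T(1) _ vX v])
        fix B assume "B \<in> T (Suc l)"
        then obtain A' where "A' \<in> \<G>" "B = A' \<inter> X" by (auto simp: T_def)
        then show "B \<inter> (A \<inter> X) \<noteq> {}" using X(3)[of A' A] A(1) by auto
      qed (use A in auto)
      moreover have "s choose l \<le> (2 * r - 1 - card (A \<inter> X)) choose l"
      proof (rule binomial_right_mono)
        have "card (A \<inter> X) \<le> r" using finA card_mono[of A "A \<inter> X"] by simp
        then show "s \<le> 2 * r - 1 - card (A \<inter> X)" by (simp add: s_def)
      qed
      ultimately show ?thesis using X(2) by simp
    qed
  qed
  have T_top: "card (T r) \<le> (2 * r - 1) choose s"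
    unfolding s_def using card_intersecting_half_le[OF finX X(2) _ T] r2 by simp
  have T_0: "T 0 = {}"
  proof -
    have "card (A \<inter> X) \<noteq> 0" if "A \<in> \<G>" for A
    proof -
      have "A \<inter> X \<noteq> {}" using X(3)[OF that that] by auto
      then show ?thesis using finX by simp
    qed
    then show ?thesis unfolding T_def by blast
  qed
  define N where "N = card V - 2 * r"
  have r: "r = Suc s" using r2 by (simp add: s_def)
  have "card \<G> \<le> (\<Sum>i\<le>r. card (T i) * (N choose (r - i)))"
    using card_uniform_trace_le[OF less.prems(1) X(1) G(1)] X(2) by (simp add: T_def N_def)
  also have "\<dots> = (\<Sum>l\<le>s. card (T (Suc l)) * (N choose (s - l)))"
    unfolding r by (subst sum.atMost_Suc_shift) (simp add: T_0)
  finally have "card \<G> + (\<Sum>l\<le>s. (s choose l) * (N choose (s - l)))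
      \<le> (\<Sum>l\<le>s. (card (T (Suc l)) + (s choose l)) * (N choose (s - l)))"
    by (simp add: add_mult_distrib sum.distrib)
  also have "\<dots> \<le> (\<Sum>l\<le>s. ((2 * r - 1) choose l) * (N choose (s - l)) + of_bool (l = s))"
  proof (rule sum_mono)
    fix l assume "l \<in> {..s}"
    then consider "l < s" | "l = s" by fastforce
    then show "(card (T (Suc l)) + (s choose l)) * (N choose (s - l))
        \<le> ((2 * r - 1) choose l) * (N choose (s - l)) + of_bool (l = s)"
    proof cases
      case 1
      then show ?thesis using T_bound[OF 1] by simp
    next
      case 2
      then show ?thesis using T_top by (simp add: r)
    qed
  qed
  also have "\<dots> = (\<Sum>l\<le>s. ((2 * r - 1) choose l) * (N choose (s - l))) + 1"
    by (simp add: sum.distrib)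
  finally have "card \<G> + ((s + N) choose s) \<le> ((2 * r - 1 + N) choose s) + 1"
    by (simp only: vandermonde)
  moreover have "s + N = card V - r - 1" "2 * r - 1 + N = card V - 1"
    using less.prems(2) r2 by (auto simp: s_def N_def)
  ultimately have "card \<G> + ((card V - r - 1) choose s) \<le> ((card V - 1) choose s) + 1"
    by (simp only:)
  then show ?case using G(4) unfolding s_def by linarith
qed

section \<open>Families of bounded diameter\<close>

text \<open>Translation by \<open>S\<close> is an involution, so it can be moved from the ball or
  cylinder to the family.\<close>

lemma subset_translate_iff: "\<F> \<subseteq> translate \<K> S \<longleftrightarrow> (\<lambda>A. sym_diff A S) ` \<F> \<subseteq> \<K>"
proof -
  have inv: "sym_diff (sym_diff A S) S = A" for A by auto
  show ?thesis
  proof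
    assume "\<F> \<subseteq> translate \<K> S"
    then show "(\<lambda>A. sym_diff A S) ` \<F> \<subseteq> \<K>" using inv by (fastforce simp: translate_def)
  next
    assume *: "(\<lambda>A. sym_diff A S) ` \<F> \<subseteq> \<K>"
    show "\<F> \<subseteq> translate \<K> S"
    proof
      fix A assume "A \<in> \<F>"
      then have "sym_diff A S \<in> \<K>" using * by blast
      then have "sym_diff (sym_diff A S) S \<in> translate \<K> S" unfolding translate_def by (rule imageI)
      then show "A \<in> translate \<K> S" unfolding inv .
    qed
  qed
qed

lemma card_image_sym_diff: "card ((\<lambda>A. sym_diff A S) ` \<F>) = card \<F>"
  by (rule card_image, rule inj_on_inverseI[of _ "\<lambda>A. sym_diff A S"]) auto

lemma hamming_sym_diff_cancel: "hamming (sym_diff A S) (sym_diff B S) = hamming A B"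
  by (rule arg_cong[of _ _ card]) auto

lemma hamming_image_sym_diff_le:
  assumes "\<And>A B. A \<in> \<F> \<Longrightarrow> B \<in> \<F> \<Longrightarrow> hamming A B \<le> d"
    and A: "A \<in> (\<lambda>A. sym_diff A S) ` \<F>" and B: "B \<in> (\<lambda>A. sym_diff A S) ` \<F>"
  shows "hamming A B \<le> d"
proof -
  obtain A' where "A = sym_diff A' S" "A' \<in> \<F>" using A by (rule imageE)
  moreover obtain B' where "B = sym_diff B' S" "B' \<in> \<F>" using B by (rule imageE)
  ultimately show ?thesis using assms(1) by (simp only: hamming_sym_diff_cancel)
qed

lemma zchoose_of_nat: "zchoose (int n) k = int (n choose k)"
  by (simp add: zchoose_def binomial_eq_0)

lemma sum_zchoose_of_nat: "(\<Sum>i=0..k. zchoose (int n) i) = int (\<Sum>i\<le>k. n choose i)"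
  by (simp add: zchoose_of_nat atLeast0AtMost)

lemma card_ball:
  assumes "finite V"
  shows "card {S. S \<subseteq> V \<and> card S \<le> k} = (\<Sum>i\<le>k. card V choose i)"
proof -
  have "{S. S \<subseteq> V \<and> card S \<le> k} = (\<Union>i\<in>{..k}. {S. S \<subseteq> V \<and> card S = i})" by auto
  also have "card \<dots> = (\<Sum>i\<le>k. card {S. S \<subseteq> V \<and> card S = i})"
    using assms by (intro card_UN_disjoint) auto
  finally show ?thesis using assms by (simp add: n_subsets)
qed

lemma sum_choose_Suc:
  "(\<Sum>i\<le>k. Suc m choose i) + (m choose k) = 2 * (\<Sum>i\<le>k. m choose i)"
  by (induction k) auto

lemma card_bound_or_subset_translate_ball:
  assumes n: "n > 0" and sub: "\<F> \<subseteq> Pow {1..n}"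
    and diam: "\<And>A B. A \<in> \<F> \<Longrightarrow> B \<in> \<F> \<Longrightarrow> hamming A B \<le> 2 * k + 1"
    and not_sub: "\<not> (\<exists>S\<subseteq>{1..n}. \<F> \<subseteq> translate (K_ball n (k + 1)) S)"
  shows "int (card \<F>) \<le> 2 * (\<Sum>i=0..k. zchoose (int n) i) - 2 * zchoose (int n - 5 * int k - 1) k"
proof -
  let ?V = "{1..n}"
  have far: "\<exists>C\<in>\<F>. k + 2 \<le> hamming C S" if "S \<subseteq> ?V" for S
  proof -
    have "\<not> \<F> \<subseteq> translate (K_ball n (k + 1)) S" using not_sub that by blast
    then obtain C where C: "C \<in> \<F>" "sym_diff C S \<notin> K_ball n (k + 1)"
      unfolding subset_translate_iff by (auto simp only: image_subset_iff)
    moreover have "sym_diff C S \<subseteq> ?V" using C(1) sub that by blast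
    ultimately have "k + 2 \<le> hamming C S" by (simp add: K_ball_def)
    then show ?thesis using C(1) by blast
  qed
  obtain A U where A: "A \<in> \<F>" and finU: "finite U" and U: "card U \<le> 5 * k + 1"
    and block: "\<And>T F. T \<subseteq> ?V \<Longrightarrow> card T = k \<Longrightarrow> T \<inter> U = {} \<Longrightarrow> F \<in> \<F> \<Longrightarrow> \<not> T \<subseteq> sym_diff F A"
    using exists_blocking_set[OF _ sub diam far] by blast
  define \<G> where "\<G> = (\<lambda>F. sym_diff F A) ` \<F>"
  \<comment> \<open>The monomials that the blocking set makes vanish. Each is missing from
    \<open>J\<close>, and each thus lowers the final bound by 2.\<close>
  define \<T> where "\<T> = {T. T \<subseteq> ?V - U \<and> card T = k}"
  define J where "J = {S. S \<subseteq> ?V \<and> card S \<le> k} - \<T>"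
  have "card \<G> \<le> 2 * card J"
  proof (rule card_le_twice_nonvanishing_monomials[of ?V \<G> k])
    show "\<G> \<subseteq> Pow ?V" using sub A by (auto simp: \<G>_def)
    show "hamming B C \<le> 2 * k + 1" if BC: "B \<in> \<G>" "C \<in> \<G>" for B C
      by (rule hamming_image_sym_diff_le[OF _ BC[unfolded \<G>_def]]) (rule diam)
    show "\<not> S \<subseteq> B" if S: "S \<subseteq> ?V" "card S \<le> k" "S \<notin> J" and B: "B \<in> \<G>" for S B
    proof -
      have "S \<in> \<T>" using S by (auto simp: J_def)
      then have "card S = k" "S \<inter> U = {}" by (auto simp: \<T>_def)
      moreover obtain F where "B = sym_diff F A" "F \<in> \<F>" using B unfolding \<G>_def by (rule imageE)
      ultimately show ?thesis using block[OF S(1)] by blast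
    qed
  qed (auto simp: J_def)
  moreover have "card \<G> = card \<F>" unfolding \<G>_def by (rule card_image_sym_diff)
  moreover have "card J + card \<T> = (\<Sum>i\<le>k. n choose i)"
  proof -
    have "\<T> \<subseteq> {S. S \<subseteq> ?V \<and> card S \<le> k}" by (auto simp: \<T>_def)
    moreover have fin: "finite {S. S \<subseteq> ?V \<and> card S \<le> k}" by simp
    ultimately have "card J + card \<T> = card {S. S \<subseteq> ?V \<and> card S \<le> k}"
      unfolding J_def by (simp add: card_Diff_subset card_mono finite_subset)
    then show ?thesis by (simp add: card_ball)
  qed
  moreover have "zchoose (int n - 5 * int k - 1) k \<le> int (card \<T>)"
  proof (cases "int n - 5 * int k - 1 < int k")
    case True
    then show ?thesis by (simp add: zchoose_def)
  next
    case False
    have "nat (int n - 5 * int k - 1) \<le> card (?V - U)"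
      using diff_card_le_card_Diff[OF finU, of ?V] U by simp
    then have "nat (int n - 5 * int k - 1) choose k \<le> card (?V - U) choose k"
      by (rule binomial_right_mono)
    then show ?thesis using False by (simp add: zchoose_def \<T>_def n_subsets)
  qed
  ultimately show ?thesis unfolding sum_zchoose_of_nat by linarith
qed

lemma subset_cyl_or_card_bound:
  assumes n: "2 * k + 2 \<le> n" and sub: "\<G> \<subseteq> K_ball n (k + 1)"
    and diam: "\<And>A B. A \<in> \<G> \<Longrightarrow> B \<in> \<G> \<Longrightarrow> hamming A B \<le> 2 * k + 1"
  shows "(\<exists>y\<in>{1..n}. \<G> \<subseteq> K_cyl y n k) \<or>
    card \<G> + ((n - k - 2) choose k) \<le> 2 * (\<Sum>i\<le>k. (n - 1) choose i) + 1"
proof -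
  let ?V = "{1..n}"
  define L where "L = {A \<in> \<G>. card A = k + 1}"
  have unif: "uniform ?V (k + 1) L" using sub by (auto simp: uniform_def L_def K_ball_def)
  have inter: "intersecting L"
    unfolding intersecting_def
  proof (intro ballI notI)
    fix A B assume AB: "A \<in> L" "B \<in> L" "A \<inter> B = {}"
    then have "finite A" "finite B" "sym_diff A B = A \<union> B"
      using unif by (auto simp: uniform_def intro: finite_subset)
    then have "hamming A B = 2 * k + 2" using AB by (simp add: card_Un_disjoint L_def)
    moreover have "hamming A B \<le> 2 * k + 1" using diam AB by (simp add: L_def)
    ultimately show False by simp
  qed
  show ?thesis
  proof (cases "nontrivial L")
    case False
    then obtain v where v: "\<And>A. A \<in> L \<Longrightarrow> v \<in> A" by (auto simp: nontrivial_def)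
    obtain y where y: "y \<in> ?V" "\<And>A. A \<in> L \<Longrightarrow> y \<in> A"
    proof (cases "L = {}")
      case True
      \<comment> \<open>With no sets of size \<open>k + 1\<close> any point serves as
        \<open>y\<close>.\<close>
      then show thesis using that[of 1] n by auto
    next
      case False
      then obtain A where "A \<in> L" by blast
      then have "v \<in> ?V" using v unif unfolding uniform_def by blast
      then show thesis using that v by blast
    qed
    have "A \<in> K_cyl y n k" if A: "A \<in> \<G>" for A
    proof -
      have A': "A \<subseteq> ?V" "card A \<le> k + 1" "finite A"
        using A sub by (auto simp: K_ball_def intro: finite_subset)
      have "card (A - {y}) \<le> k"
      proof (cases "A \<in> L")
        case True
        then show ?thesis using y A' by simp
      next
        case False
        then have "card A \<le> k" using A A' by (auto simp: L_def)
        then show ?thesis using card_Diff1_le[of A y] by linarith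
      qed
      then show ?thesis using A' by (simp add: K_cyl_def)
    qed
    then show ?thesis using y(1) by blast
  next
    case True
    have HM: "card L + ((n - k - 2) choose k) \<le> ((n - 1) choose k) + 1"
      using Hilton_Milner[OF _ _ unif inter True] n by simp
    have fin: "finite \<G>" using sub by (rule finite_subset) (simp add: K_ball_def)
    have "\<G> \<subseteq> {S. S \<subseteq> ?V \<and> card S \<le> k} \<union> L" using sub by (auto simp: K_ball_def L_def)
    then have "card \<G> \<le> card ({S. S \<subseteq> ?V \<and> card S \<le> k} \<union> L)"
      using fin by (intro card_mono) (auto simp: L_def)
    also have "\<dots> \<le> (\<Sum>i\<le>k. n choose i) + card L"
      using card_Un_le[of "{S. S \<subseteq> ?V \<and> card S \<le> k}" L] by (simp add: card_ball)
    \<comment> \<open>By Pascal's rule the sum for \<open>n\<close> is twice the sum for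
      \<open>n - 1\<close> minus \<open>(n - 1) choose k\<close>, which cancels the main term of the
      Hilton--Milner bound.\<close>
    finally show ?thesis
      using HM sum_choose_Suc[where k = k and m = "n - 1"] n by simp
  qed
qed

theorem theorem1p8:
  fixes n k :: nat and \<F> :: "nat set set"
  assumes "n > 0"
    and "\<F> \<subseteq> Pow {1..n}"
    and "\<forall>A\<in>\<F>. \<forall>B\<in>\<F>. card (sym_diff A B) \<le> 2 * k + 1"
  shows "(int (card \<F>) \<le> 2 * (\<Sum>i=0..k. zchoose (int n) i)
              - 2 * zchoose (int n - 5 * int k - 1) k
          \<or> (\<exists>S\<subseteq>{1..n}. \<F> \<subseteq> translate (K_ball n (k + 1)) S))
    \<and> (n \<le> k + 2 \<or> 2 * k + 2 \<le> n \<longrightarrow> (\<exists>S\<subseteq>{1..n}. \<F> \<subseteq> translate (K_ball n (k + 1)) S) \<longrightarrow>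
          (\<exists>y\<in>{1..n}. \<exists>S\<subseteq>{1..n}. \<F> \<subseteq> translate (K_cyl y n k) S)
          \<or> int (card \<F>) \<le> 2 * (\<Sum>i=0..k. zchoose (int n - 1) i)
              - zchoose (int n - int k - 2) k + 1)"
proof (intro conjI impI)
  show "int (card \<F>) \<le> 2 * (\<Sum>i=0..k. zchoose (int n) i) - 2 * zchoose (int n - 5 * int k - 1) k
      \<or> (\<exists>S\<subseteq>{1..n}. \<F> \<subseteq> translate (K_ball n (k + 1)) S)"
    using card_bound_or_subset_translate_ball[OF assms(1,2)] assms(3) by blast
next
  assume range: "n \<le> k + 2 \<or> 2 * k + 2 \<le> n"
    and "\<exists>S\<subseteq>{1..n}. \<F> \<subseteq> translate (K_ball n (k + 1)) S"
  then obtain S where S: "S \<subseteq> {1..n}" "\<F> \<subseteq> translate (K_ball n (k + 1)) S" by blast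
  define \<G> where "\<G> = (\<lambda>A. sym_diff A S) ` \<F>"
  have G: "\<G> \<subseteq> K_ball n (k + 1)" using S(2) by (simp only: subset_translate_iff \<G>_def)
  have card_G: "card \<G> = card \<F>" unfolding \<G>_def by (rule card_image_sym_diff)
  have n1: "int n - 1 = int (n - 1)" using assms(1) by simp
  have "(\<exists>y\<in>{1..n}. \<G> \<subseteq> K_cyl y n k) \<or>
    int (card \<G>) \<le> 2 * int (\<Sum>i\<le>k. (n - 1) choose i) - zchoose (int n - int k - 2) k + 1"
  proof (cases "2 * k + 2 \<le> n")
    case True
    have "hamming A B \<le> 2 * k + 1" if AB: "A \<in> \<G>" "B \<in> \<G>" for A B
      by (rule hamming_image_sym_diff_le[OF _ AB[unfolded \<G>_def]]) (use assms(3) in blast)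
    then have "(\<exists>y\<in>{1..n}. \<G> \<subseteq> K_cyl y n k) \<or>
        card \<G> + ((n - k - 2) choose k) \<le> 2 * (\<Sum>i\<le>k. (n - 1) choose i) + 1"
      by (rule subset_cyl_or_card_bound[OF True G])
    then show ?thesis
    proof
      have "int n - int k - 2 = int (n - k - 2)" using True by simp
      then have zc: "zchoose (int n - int k - 2) k = int ((n - k - 2) choose k)"
        by (simp only: zchoose_of_nat)
      assume "card \<G> + ((n - k - 2) choose k) \<le> 2 * (\<Sum>i\<le>k. (n - 1) choose i) + 1"
      then show ?thesis unfolding zc by linarith
    qed (rule disjI1)
  next
    case False
    show ?thesis
    proof (cases "n \<le> k + 1")
      case True
      have "\<G> \<subseteq> K_cyl 1 n k"
      proof
        fix A assume "A \<in> \<G>"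
        then have A: "A \<subseteq> {1..n}" using G by (auto simp: K_ball_def)
        then have "card (A - {1}) \<le> card ({1..n} - {1})" by (intro card_mono) auto
        then show "A \<in> K_cyl 1 n k" using A True assms(1) by (simp add: K_cyl_def)
      qed
      then show ?thesis using assms(1) by (intro disjI1 bexI[of _ 1]) auto
    next
      case n_large: False
      \<comment> \<open>Here the ball consists of all subsets except \<open>{1..n}\<close>, and its
        size \<open>2 ^ n - 1\<close> equals the bound exactly. Positivity of \<open>k\<close> makes
        the subtracted binomial coefficient 0.\<close>
      then have n: "n = k + 2" and k: "k > 0" using range False by auto
      have "\<G> \<subseteq> Pow {1..n} - {{1..n}}" using G n by (auto simp: K_ball_def)
      then have "card \<G> \<le> card (Pow {1..n} - {{1..n}})" by (intro card_mono) auto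
      also have "\<dots> = 2 ^ n - 1" by (simp add: card_Pow)
      finally have "card \<G> \<le> 2 * 2 ^ (k + 1) - 1" by (simp add: n)
      moreover have "(\<Sum>i\<le>k. (k + 1) choose i) + 1 = 2 ^ (k + 1)"
        using choose_row_sum[of "k + 1"] by simp
      moreover have "zchoose (int n - int k - 2) k = 0" using n k by (simp add: zchoose_def)
      moreover have "(1::nat) \<le> 2 ^ (k + 1)" by simp
      ultimately have "int (card \<G>) \<le> 2 * int (\<Sum>i\<le>k. (k + 1) choose i) - zchoose (int n - int k - 2) k + 1"
        by linarith
      then show ?thesis by (simp add: n)
    qed
  qed
  then show "(\<exists>y\<in>{1..n}. \<exists>S\<subseteq>{1..n}. \<F> \<subseteq> translate (K_cyl y n k) S)
      \<or> int (card \<F>) \<le> 2 * (\<Sum>i=0..k. zchoose (int n - 1) i) - zchoose (int n - int k - 2) k + 1"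
    unfolding n1 sum_zchoose_of_nat subset_translate_iff card_G using S(1) \<G>_def by blast
qed

end
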